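(* Let $G$ be a snark and let $v$ be a vertex of $G$. Let $G^v$ be the graph obtained from $G$ by inflating $v$ to a triangle $T$. Then $G^v$ has a hexagonal core intersecting $T$ (i.e. sharing at least one vertex with $T$) if and only if $v$ lies on a heavy pentagon of $G$.
   Context: Graphs are finite; loops and multiple edges are allowed. A snark is a $2$-connected cubic graph admitting no proper $3$-edge-colouring. Inflating a vertex $v$ of a cubic graph to a triangle means deleting $v$, adding a new triangle $T$ on three new vertices, and attaching the three edge-ends formerly incident with $v$ to the three distinct vertices of $T$, one to each. A $3$-array of a bridgeless cubic graph $H$ is a set $\mathcal{M}=\{M_1,M_2,M_3\}$ of three perfect matchings of $H$; an edge is uncovered if it lies in no $M_i$ and simply covered if it lies in exactly one $M_i$. The colouring defect $\mathrm{df}(H)$ is the minimum number of edges left uncovered by a $3$-array of $H$; a $3$-array attaining it is optimal. The core of $\mathcal{M}$ is the subgraph formed by all edges that are not simply covered. It is known that every snark has defect at least $3$, and that if $\mathrm{df}(H)=3$ then the core of every optimal $3$-array is an induced $6$-cycle; such a core of an optimal $3$-array of a graph of defect $3$ is called a hexagonal core. A pentagon (circuit of length $5$) $D$ in $G$ is heavy if $D$ contains an edge $uv$ such that the graph $G-\{u,v\}$ admits a proper $3$-edge-colouring. *)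

theory Defs
  imports Main "HOL-Library.Multiset"
begin

text \<open>A multigraph: vertex set, edge set, and for every edge the multiset of its two
  end-vertices (a loop at x has ends {#x,x#}).\<close>

record ('v, 'e) mgraph =
  verts :: "'v set"
  edges :: "'e set"
  ends  :: "'e \<Rightarrow> 'v multiset"

definition wf_graph :: "('v, 'e) mgraph \<Rightarrow> bool" where
  "wf_graph G \<longleftrightarrow> finite (verts G) \<and> finite (edges G) \<and>
     (\<forall>e \<in> edges G. size (ends G e) = 2 \<and> set_mset (ends G e) \<subseteq> verts G)"

definition deg_in :: "('v, 'e) mgraph \<Rightarrow> 'e set \<Rightarrow> 'v \<Rightarrow> nat" where
  "deg_in G F x = (\<Sum>e \<in> F. count (ends G e) x)"

definition cubic :: "('v, 'e) mgraph \<Rightarrow> bool" where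
  "cubic G \<longleftrightarrow> wf_graph G \<and> (\<forall>x \<in> verts G. deg_in G (edges G) x = 3)"

definition adj :: "('v, 'e) mgraph \<Rightarrow> 'v \<Rightarrow> 'v \<Rightarrow> bool" where
  "adj G x y \<longleftrightarrow> (\<exists>e \<in> edges G. ends G e = {#x, y#})"

definition connected :: "('v, 'e) mgraph \<Rightarrow> bool" where
  "connected G \<longleftrightarrow> (\<forall>x \<in> verts G. \<forall>y \<in> verts G. (adj G)\<^sup>*\<^sup>* x y)"

definition del_verts :: "('v, 'e) mgraph \<Rightarrow> 'v set \<Rightarrow> ('v, 'e) mgraph" where
  "del_verts G S = \<lparr> verts = verts G - S,
                     edges = {e \<in> edges G. set_mset (ends G e) \<inter> S = {}},
                     ends = ends G \<rparr>"

definition two_connected :: "('v, 'e) mgraph \<Rightarrow> bool" where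
  "two_connected G \<longleftrightarrow> card (verts G) \<ge> 3 \<and> connected G \<and>
     (\<forall>x \<in> verts G. connected (del_verts G {x}))"

text \<open>Proper 3-edge-colouring: every vertex sees each colour at most once
  (so loops can never be coloured).\<close>
definition proper_3_edge_colouring :: "('v, 'e) mgraph \<Rightarrow> ('e \<Rightarrow> nat) \<Rightarrow> bool" where
  "proper_3_edge_colouring G c \<longleftrightarrow>
     (\<forall>e \<in> edges G. c e < 3) \<and>
     (\<forall>x \<in> verts G. \<forall>i < 3. deg_in G {e \<in> edges G. c e = i} x \<le> 1)"

definition colourable3 :: "('v, 'e) mgraph \<Rightarrow> bool" where
  "colourable3 G \<longleftrightarrow> (\<exists>c. proper_3_edge_colouring G c)"

definition snark :: "('v, 'e) mgraph \<Rightarrow> bool" where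
  "snark G \<longleftrightarrow> cubic G \<and> two_connected G \<and> \<not> colourable3 G"

definition perfect_matching :: "('v, 'e) mgraph \<Rightarrow> 'e set \<Rightarrow> bool" where
  "perfect_matching G M \<longleftrightarrow> M \<subseteq> edges G \<and> (\<forall>x \<in> verts G. deg_in G M x = 1)"

definition three_array :: "('v, 'e) mgraph \<Rightarrow> (nat \<Rightarrow> 'e set) \<Rightarrow> bool" where
  "three_array G M \<longleftrightarrow> (\<forall>i < 3. perfect_matching G (M i))"

definition cover_count :: "(nat \<Rightarrow> 'e set) \<Rightarrow> 'e \<Rightarrow> nat" where
  "cover_count M e = card {i. i < 3 \<and> e \<in> M i}"

definition uncovered :: "('v, 'e) mgraph \<Rightarrow> (nat \<Rightarrow> 'e set) \<Rightarrow> 'e set" where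
  "uncovered G M = {e \<in> edges G. cover_count M e = 0}"

definition defect :: "('v, 'e) mgraph \<Rightarrow> nat" where
  "defect G = (LEAST n. \<exists>M. three_array G M \<and> card (uncovered G M) = n)"

definition optimal_array :: "('v, 'e) mgraph \<Rightarrow> (nat \<Rightarrow> 'e set) \<Rightarrow> bool" where
  "optimal_array G M \<longleftrightarrow> three_array G M \<and> card (uncovered G M) = defect G"

definition core_edges :: "('v, 'e) mgraph \<Rightarrow> (nat \<Rightarrow> 'e set) \<Rightarrow> 'e set" where
  "core_edges G M = {e \<in> edges G. cover_count M e \<noteq> 1}"

definition core_verts :: "('v, 'e) mgraph \<Rightarrow> (nat \<Rightarrow> 'e set) \<Rightarrow> 'v set" where
  "core_verts G M = (\<Union>e \<in> core_edges G M. set_mset (ends G e))"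

text \<open>H has a hexagonal core (core of an optimal 3-array of a defect-3 graph)
  sharing a vertex with S.\<close>
definition has_hex_core_meeting :: "('v, 'e) mgraph \<Rightarrow> 'v set \<Rightarrow> bool" where
  "has_hex_core_meeting H S \<longleftrightarrow>
     defect H = 3 \<and> (\<exists>M. optimal_array H M \<and> core_verts H M \<inter> S \<noteq> {})"

text \<open>Edges incident with v.  (In a snark there are no loops, so these are exactly
  three distinct edges, i.e. the three edge-ends at v.)\<close>
definition inc_edges :: "('v, 'e) mgraph \<Rightarrow> 'v \<Rightarrow> 'e set" where
  "inc_edges G v = {e \<in> edges G. v \<in># ends G e}"

text \<open>New triangle vertices: Inr e for each edge e at v; triangle edges: Inr {e1,e2}.\<close>
definition inflate :: "('v, 'e) mgraph \<Rightarrow> 'v \<Rightarrow> ('v + 'e, 'e + 'e set) mgraph" where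
  "inflate G v = \<lparr>
     verts = Inl ` (verts G - {v}) \<union> Inr ` inc_edges G v,
     edges = Inl ` edges G \<union>
             Inr ` {{e1, e2} | e1 e2. e1 \<in> inc_edges G v \<and> e2 \<in> inc_edges G v \<and> e1 \<noteq> e2},
     ends = (\<lambda>f. case f of
               Inl e \<Rightarrow> image_mset (\<lambda>x. if x = v then Inr e else Inl x) (ends G e)
             | Inr s \<Rightarrow> image_mset Inr (mset_set s)) \<rparr>"

definition triangle :: "('v, 'e) mgraph \<Rightarrow> 'v \<Rightarrow> ('v + 'e) set" where
  "triangle G v = Inr ` inc_edges G v"

definition pentagon :: "('v, 'e) mgraph \<Rightarrow> 'v list \<Rightarrow> 'e list \<Rightarrow> bool" where
  "pentagon G xs es \<longleftrightarrow> length xs = 5 \<and> length es = 5 \<and> distinct xs \<and> distinct es \<and>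
     set xs \<subseteq> verts G \<and>
     (\<forall>i < 5. es ! i \<in> edges G \<and> ends G (es ! i) = {# xs ! i, xs ! ((i + 1) mod 5) #})"

definition heavy_pentagon :: "('v, 'e) mgraph \<Rightarrow> 'v list \<Rightarrow> 'e list \<Rightarrow> bool" where
  "heavy_pentagon G xs es \<longleftrightarrow> pentagon G xs es \<and>
     (\<exists>i < 5. colourable3 (del_verts G {xs ! i, xs ! ((i + 1) mod 5)}))"

definition on_heavy_pentagon :: "('v, 'e) mgraph \<Rightarrow> 'v \<Rightarrow> bool" where
  "on_heavy_pentagon G v \<longleftrightarrow> (\<exists>xs es. heavy_pentagon G xs es \<and> v \<in> set xs)"

end

theory Submission
  imports Defs
begin

text \<open>
  Write H for the inflated graph; it is cubic and not 3-edge-colourable. Any two perfect matchings of H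
  intersect, since otherwise the two matchings and their complement would be a colouring. A count of covered
  edges then shows that a 3-array of H leaves at least three edges uncovered, and that in case of
  equality the three pairwise intersections are single edges \<open>d 0\<close>, \<open>d 1\<close>, \<open>d 2\<close> which form
  an alternating hexagon with the uncovered edges. If the hexagon meets the triangle, it uses exactly one
  triangle edge, which is uncovered. Contracting the triangle yields a pentagon through v, and
  deleting the ends of the double edge opposite to v leaves a graph which the matchings colour.

  Conversely, a colouring of the graph without the ends of an edge of a pentagon extends to the edges
  outside the pentagon. By parity the five edges leaving the pentagon carry one colour three times and
  the others once. The three equally coloured ones are not consecutive, since otherwise the colouring
  would extend to the pentagon; so the two exceptional edges leave from the neighbours of one pentagon
  vertex, the centre. A Kempe switch moves the centre by two steps around the pentagon, hence it can be moved to
  v, and then the colouring yields a 3-array of H with three uncovered edges.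
\<close>

section \<open>Loopless multigraphs\<close>

definition loopless :: "('v, 'e) mgraph \<Rightarrow> bool" where
  "loopless G \<longleftrightarrow> (\<forall>e \<in> edges G. \<forall>x. count (ends G e) x \<le> 1)"

lemma ends_eq_pair:
  assumes "wf_graph G" "loopless G" "e \<in> edges G" "x \<in># ends G e"
  obtains y where "ends G e = {#x, y#}" "x \<noteq> y" "x \<in> verts G" "y \<in> verts G"
proof -
  obtain N where N: "ends G e = add_mset x N"
    using assms(4) by (metis insert_DiffM)
  have "size (ends G e) = 2" and sub: "set_mset (ends G e) \<subseteq> verts G"
    using assms(1,3) unfolding wf_graph_def by auto
  with N have "size N = 1" by simp
  then obtain y where y: "N = {#y#}" using size_1_singleton_mset by blast
  have "count (ends G e) x \<le> 1" using assms(2,3) unfolding loopless_def by blast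
  then have "x \<noteq> y" using N y by (auto split: if_splits)
  then show thesis using that[of y] N y sub by auto
qed

lemma ends_pair_cases:
  assumes "wf_graph G" "loopless G" "e \<in> edges G"
  obtains x y where "ends G e = {#x, y#}" "x \<noteq> y" "x \<in> verts G" "y \<in> verts G"
proof -
  have "size (ends G e) = 2" using assms(1,3) unfolding wf_graph_def by auto
  then have "ends G e \<noteq> {#}" by auto
  then obtain x where "x \<in># ends G e" by blast
  then show thesis using ends_eq_pair[OF assms] that by metis
qed

lemma ends_eq_pair_of_mem:
  assumes "wf_graph G" "loopless G" "e \<in> edges G" "x \<in># ends G e" "y \<in># ends G e" "x \<noteq> y"
  shows "ends G e = {#x, y#}"
proof -
  obtain z where "ends G e = {#x, z#}" using ends_eq_pair[OF assms(1-4)] .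
  then show ?thesis using assms(5,6) by auto
qed

lemma finite_inc_edges: "wf_graph G \<Longrightarrow> finite (inc_edges G x)"
  unfolding wf_graph_def inc_edges_def by auto

text \<open>Without loops every multiplicity in \<open>ends\<close> is 0 or 1, so the degree sum
  counts incident edges.\<close>

lemma deg_in_eq_card:
  assumes "wf_graph G" "loopless G" "F \<subseteq> edges G"
  shows "deg_in G F x = card {e \<in> F. x \<in># ends G e}"
proof -
  have fin: "finite F" using assms unfolding wf_graph_def by (auto intro: finite_subset)
  have "count (ends G e) x = (if x \<in># ends G e then 1 else 0)" if "e \<in> F" for e
  proof -
    have "count (ends G e) x \<le> 1" using that assms(2,3) unfolding loopless_def by blast
    then show ?thesis by (cases "count (ends G e) x") (auto simp: count_eq_zero_iff[symmetric])
  qed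
  then have "deg_in G F x = (\<Sum>e\<in>F. if x \<in># ends G e then 1 else 0)"
    unfolding deg_in_def by (auto intro: sum.cong)
  also have "\<dots> = card {e \<in> F. x \<in># ends G e}"
    using fin by (simp add: sum.If_cases Int_def)
  finally show ?thesis .
qed

lemma deg_in_edges:
  assumes "wf_graph G" "loopless G"
  shows "deg_in G (edges G) x = card (inc_edges G x)"
  using deg_in_eq_card[OF assms, of "edges G" x] by (simp add: inc_edges_def)

lemma handshake:
  assumes "wf_graph G" "F \<subseteq> edges G"
  shows "(\<Sum>x\<in>verts G. deg_in G F x) = 2 * card F"
proof -
  have "(\<Sum>x\<in>verts G. deg_in G F x) = (\<Sum>e\<in>F. \<Sum>x\<in>verts G. count (ends G e) x)"
    unfolding deg_in_def by (rule sum.swap)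
  also have "\<dots> = (\<Sum>e\<in>F. 2)"
  proof (rule sum.cong[OF refl])
    fix e assume "e \<in> F"
    then have "size (ends G e) = 2" "set_mset (ends G e) \<subseteq> verts G" "finite (verts G)"
      using assms unfolding wf_graph_def by auto
    then show "(\<Sum>x\<in>verts G. count (ends G e) x) = 2"
      by (metis (no_types, lifting) size_multiset_overloaded_eq sum.mono_neutral_left
          count_eq_zero_iff DiffD2)
  qed
  finally show ?thesis by simp
qed

text \<open>Each colour occurs at most once at \<open>x\<close> exactly when no two edges at
  \<open>x\<close> share a colour. This injectivity form is the working definition of a colouring
  below.\<close>

lemma proper_3_edge_colouring_iff:
  assumes "wf_graph G" "loopless G"
  shows "proper_3_edge_colouring G c \<longleftrightarrow>
    (\<forall>e \<in> edges G. c e < 3) \<and> (\<forall>x \<in> verts G. inj_on c (inc_edges G x))"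
proof -
  have "(\<forall>i<3. deg_in G {e \<in> edges G. c e = i} x \<le> 1) \<longleftrightarrow> inj_on c (inc_edges G x)"
    if c: "\<forall>e \<in> edges G. c e < 3" for x
  proof -
    have d: "deg_in G {e \<in> edges G. c e = i} x = card {e \<in> inc_edges G x. c e = i}" for i
      by (subst deg_in_eq_card[OF assms]) (auto simp: inc_edges_def intro!: arg_cong[of _ _ card])
    have "finite {e \<in> inc_edges G x. c e = i}" for i
      using finite_inc_edges[OF assms(1)] by simp
    then have "card {e \<in> inc_edges G x. c e = i} \<le> 1 \<longleftrightarrow>
      (\<forall>e f. e \<in> inc_edges G x \<and> c e = i \<and> f \<in> inc_edges G x \<and> c f = i \<longrightarrow> e = f)" for i
      by (auto simp: card_le_Suc0_iff_eq)
    moreover have "\<forall>e \<in> inc_edges G x. c e < 3" using c by (auto simp: inc_edges_def)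
    ultimately show ?thesis unfolding d inj_on_def by blast
  qed
  then show ?thesis unfolding proper_3_edge_colouring_def by blast
qed

lemma perfect_matching_iff:
  assumes "wf_graph G" "loopless G"
  shows "perfect_matching G M \<longleftrightarrow>
    M \<subseteq> edges G \<and> (\<forall>x \<in> verts G. \<exists>!e. e \<in> M \<and> x \<in># ends G e)"
proof -
  have "deg_in G M x = 1 \<longleftrightarrow> (\<exists>!e. e \<in> M \<and> x \<in># ends G e)" if "M \<subseteq> edges G" for x
    unfolding deg_in_eq_card[OF assms that] card_1_singleton_iff One_nat_def
    by (auto simp: set_eq_iff) metis+
  then show ?thesis unfolding perfect_matching_def by blast
qed

lemma wf_graph_del_verts: "wf_graph G \<Longrightarrow> wf_graph (del_verts G S)"
  unfolding wf_graph_def del_verts_def by auto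

lemma loopless_del_verts: "loopless G \<Longrightarrow> loopless (del_verts G S)"
  unfolding loopless_def del_verts_def by auto

text \<open>A loop at \<open>x\<close> takes up two of its three edge-ends, so a single further edge
  \<open>f\<close> leaves \<open>x\<close>. Its other end \<open>y\<close> is then a cut vertex
  separating \<open>x\<close> from any third vertex, against 2-connectedness.\<close>

lemma snark_loopless:
  assumes "snark G"
  shows "loopless G"
  unfolding loopless_def
proof (intro ballI allI, rule ccontr)
  fix e x assume e: "e \<in> edges G" and "\<not> count (ends G e) x \<le> 1"
  have cub: "cubic G" and tc: "two_connected G" using assms unfolding snark_def by auto
  have wf: "wf_graph G" using cub unfolding cubic_def by auto
  then have fin: "finite (edges G)" "finite (verts G)" unfolding wf_graph_def by auto
  have c2: "count (ends G e) x \<ge> 2" using \<open>\<not> count (ends G e) x \<le> 1\<close> by simp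
  have sz: "size (ends G e) = 2" using wf e unfolding wf_graph_def by auto
  have x: "x \<in> verts G"
    using wf e c2 unfolding wf_graph_def
    by (metis count_inI not_numeral_le_zero subsetD)
  have loop: "ends G e = {#x, x#}"
  proof -
    have "{#x, x#} \<subseteq># ends G e"
      using c2 by (auto simp: subseteq_mset_def)
    then show ?thesis using sz by (metis mset_subset_size subset_mset.le_imp_less_or_eq
          size_add_mset size_empty less_irrefl_nat One_nat_def Suc_1)
  qed
  have "deg_in G (edges G) x = count (ends G e) x + deg_in G (edges G - {e}) x"
    unfolding deg_in_def using fin e by (simp add: sum.remove)
  moreover have "deg_in G (edges G) x = 3" using cub x unfolding cubic_def by auto
  ultimately have s1: "(\<Sum>f\<in>edges G - {e}. count (ends G f) x) = 1"
    using loop unfolding deg_in_def by simp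
  then have "\<exists>f\<in>edges G - {e}. count (ends G f) x = 1 \<and>
      (\<forall>g\<in>edges G - {e}. f \<noteq> g \<longrightarrow> count (ends G g) x = 0)"
    using fin sum_eq_1_iff[of "edges G - {e}" "\<lambda>f. count (ends G f) x"] by simp
  then obtain f where f: "f \<in> edges G - {e}" "count (ends G f) x = 1"
    and rest: "\<And>g. g \<in> edges G - {e} \<Longrightarrow> g \<noteq> f \<Longrightarrow> count (ends G g) x = 0"
    by metis
  obtain N where N: "ends G f = add_mset x N"
    using f(2) by (metis count_inI insert_DiffM zero_neq_one)
  have "size (ends G f) = 2" and sub: "set_mset (ends G f) \<subseteq> verts G"
    using wf f(1) unfolding wf_graph_def by auto
  with N have "size N = 1" by simp
  then obtain y where y: "N = {#y#}" using size_1_singleton_mset by blast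
  have "y \<noteq> x" "y \<in> verts G" using N y f(2) sub by auto
  have "card (verts G) \<ge> 3" using tc unfolding two_connected_def by auto
  then have "\<not> verts G \<subseteq> {x, y}"
    using card_mono[of "{x,y}" "verts G"] \<open>y \<noteq> x\<close> by auto
  then obtain z where z: "z \<in> verts G" "z \<noteq> x" "z \<noteq> y" by auto
  \<comment> \<open>Once \<open>y\<close> is deleted, only the loop remains at \<open>x\<close>, so
    nothing else can be reached from \<open>x\<close>.\<close>
  have stay: "b = x" if "adj (del_verts G {y}) x b" for b
  proof -
    from that obtain g where g: "g \<in> edges G" "y \<notin># ends G g" "ends G g = {#x, b#}"
      unfolding adj_def del_verts_def by auto
    have "g \<noteq> f" using g N y by auto
    then have "g = e" using rest[of g] g by auto
    then show ?thesis using loop g by (auto simp: add_eq_conv_ex)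
  qed
  have "(adj (del_verts G {y}))\<^sup>*\<^sup>* x z"
    using tc x z \<open>y \<noteq> x\<close> \<open>y \<in> verts G\<close> unfolding two_connected_def connected_def
    by (auto simp: del_verts_def)
  then have "z = x" by (induction rule: rtranclp_induct) (use stay in auto)
  then show False using z by simp
qed

section \<open>Perfect matchings and 3-arrays\<close>

lemma card_inc_edges:
  assumes "cubic G" "loopless G" "x \<in> verts G"
  shows "card (inc_edges G x) = 3"
  using assms deg_in_edges[of G x] unfolding cubic_def by auto

lemma third_edge:
  assumes "cubic G" "loopless G" "x \<in> verts G"
    and "m \<in> inc_edges G x" "n \<in> inc_edges G x" "m \<noteq> n"
  obtains l where "inc_edges G x = {m, n, l}" "l \<noteq> m" "l \<noteq> n"
proof -
  have "finite (inc_edges G x)" using assms finite_inc_edges cubic_def by metis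
  then have "card (inc_edges G x - {m, n}) = 1"
    using card_inc_edges[OF assms(1-3)] assms(4-6) by (simp add: card_Diff_subset)
  then obtain l where l: "inc_edges G x - {m, n} = {l}" using card_1_singletonE by blast
  then have "inc_edges G x = {m, n, l}" using assms(4,5) by blast
  then show thesis using that l by blast
qed

lemma matched_edge:
  assumes "wf_graph G" "loopless G" "perfect_matching G M" "x \<in> verts G"
  obtains m where "m \<in> inc_edges G x" "m \<in> M" "\<And>n. n \<in> M \<Longrightarrow> n \<in> inc_edges G x \<Longrightarrow> n = m"
proof -
  have sub: "M \<subseteq> edges G" and "\<exists>!e. e \<in> M \<and> x \<in># ends G e"
    using assms perfect_matching_iff[OF assms(1,2)] by auto
  then obtain m where "m \<in> M" "x \<in># ends G m" "\<And>n. n \<in> M \<Longrightarrow> x \<in># ends G n \<Longrightarrow> n = m" by metis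
  then show thesis using that[of m] sub unfolding inc_edges_def by blast
qed

lemma matching_unique:
  assumes "wf_graph G" "loopless G" "perfect_matching G M" "x \<in> verts G"
    and "m \<in> M" "n \<in> M" "x \<in># ends G m" "x \<in># ends G n"
  shows "m = n"
  using assms perfect_matching_iff[OF assms(1,2)] by metis

text \<open>In a cubic graph two disjoint perfect matchings leave exactly one further edge at every
  vertex, so the remaining edges serve as third colour class.\<close>

lemma disjoint_matchings_colourable3:
  assumes "cubic G" "loopless G" "perfect_matching G M" "perfect_matching G N" "M \<inter> N = {}"
  shows "colourable3 G"
proof -
  have wf: "wf_graph G" using assms(1) unfolding cubic_def by simp
  define c where "c e = (if e \<in> M then 0 else if e \<in> N then 1 else 2::nat)" for e
  have "inj_on c (inc_edges G x)" if x: "x \<in> verts G" for x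
  proof -
    obtain m where m: "m \<in> inc_edges G x" "m \<in> M"
      "\<And>n. n \<in> M \<Longrightarrow> n \<in> inc_edges G x \<Longrightarrow> n = m"
      using matched_edge[OF wf assms(2,3) x] by metis
    obtain n where n: "n \<in> inc_edges G x" "n \<in> N"
      "\<And>m. m \<in> N \<Longrightarrow> m \<in> inc_edges G x \<Longrightarrow> m = n"
      using matched_edge[OF wf assms(2,4) x] by metis
    have "m \<noteq> n" using m n assms(5) by blast
    then obtain l where l: "inc_edges G x = {m, n, l}" "l \<noteq> m" "l \<noteq> n"
      using third_edge[OF assms(1,2) x m(1) n(1)] by blast
    have "n \<notin> M" "l \<notin> M" "l \<notin> N" using m n l \<open>m \<noteq> n\<close> by blast+
    then have "c m = 0" "c n = 1" "c l = 2"
      using m(2) n(2) unfolding c_def by simp_all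
    then show ?thesis unfolding l(1) by auto
  qed
  then have "proper_3_edge_colouring G c"
    unfolding proper_3_edge_colouring_iff[OF wf assms(2)] by (auto simp: c_def)
  then show ?thesis unfolding colourable3_def by blast
qed

text \<open>Parallel edges meet the same vertices, so the exchange keeps a unique matching edge at
  each vertex. It is used to lower the number of uncovered edges and to make two matchings
  disjoint.\<close>

lemma swap_parallel_edge:
  assumes "wf_graph G" "loopless G" "perfect_matching G M"
    and "d \<in> M" "u \<in> edges G" "u \<notin> M" "ends G u = ends G d"
  shows "perfect_matching G (insert u (M - {d}))"
proof -
  have sub: "M \<subseteq> edges G" and uni: "\<And>x. x \<in> verts G \<Longrightarrow> \<exists>!e. e \<in> M \<and> x \<in># ends G e"
    using assms perfect_matching_iff[OF assms(1,2)] by auto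
  have "\<exists>!e. e \<in> insert u (M - {d}) \<and> x \<in># ends G e" if x: "x \<in> verts G" for x
  proof (cases "x \<in># ends G d")
    case True
    then have "x \<in># ends G u" using assms(7) by simp
    then show ?thesis using True uni[OF x] assms(4) by (intro ex1I[of _ u]) auto
  next
    case False
    then have "x \<notin># ends G u" using assms(7) by simp
    then show ?thesis using uni[OF x] False by (metis Diff_iff insert_iff singletonD)
  qed
  then show ?thesis using sub assms(5) unfolding perfect_matching_iff[OF assms(1,2)] by auto
qed

section \<open>Counting how often edges are covered\<close>

lemma cover_count_eq: "cover_count M e = (\<Sum>i<3. of_bool (e \<in> M i))"
  unfolding cover_count_def by (simp add: Int_def lessThan_def)

lemma card_matching:
  assumes "wf_graph G" "perfect_matching G M"
  shows "2 * card M = card (verts G)"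
  using handshake[of G M] assms unfolding perfect_matching_def by simp

text \<open>A perfect matching has half as many edges as there are vertices, and a cubic graph has
  three halves as many. Hence three perfect matchings cover an edge once on average.\<close>

lemma sum_cover_count:
  assumes "cubic G" "three_array G M"
  shows "(\<Sum>e\<in>edges G. cover_count M e) = card (edges G)"
proof -
  have wf: "wf_graph G" and fin: "finite (edges G)" using assms(1) unfolding cubic_def wf_graph_def by auto
  have pm: "perfect_matching G (M i)" if "i < 3" for i using assms(2) that unfolding three_array_def by auto
  have "2 * card (edges G) = 3 * card (verts G)"
    using handshake[OF wf, of "edges G"] assms(1) unfolding cubic_def by simp
  moreover have "2 * (\<Sum>e\<in>edges G. cover_count M e) = 3 * card (verts G)"
  proof -
    have "(\<Sum>e\<in>edges G. cover_count M e) = (\<Sum>i<3. \<Sum>e\<in>edges G. of_bool (e \<in> M i))"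
      unfolding cover_count_eq by (rule sum.swap)
    also have "\<dots> = (\<Sum>i<3. card (M i))"
    proof (rule sum.cong[OF refl])
      fix i :: nat assume "i \<in> {..<3}"
      then have "M i \<subseteq> edges G" using pm[of i] unfolding perfect_matching_def by simp
      then have "edges G \<inter> {e. e \<in> M i} = M i" by blast
      then show "(\<Sum>e\<in>edges G. of_bool (e \<in> M i)) = card (M i)"
        using fin by simp
    qed
    finally have "2 * (\<Sum>e\<in>edges G. cover_count M e) = (\<Sum>i<3. 2 * card (M i))"
      by (simp add: sum_distrib_left)
    also have "\<dots> = (\<Sum>i<(3::nat). card (verts G))"
      using card_matching[OF wf pm] by (intro sum.cong) auto
    finally show ?thesis by simp
  qed
  ultimately show ?thesis by simp
qed

lemma cover_count_le_3: "cover_count M e \<le> 3"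
  unfolding cover_count_eq by (simp add: eval_nat_numeral)

text \<open>As the average cover count is one, the deficit of the uncovered edges equals the surplus
  of the edges covered two or three times.\<close>

lemma cover_count_balance:
  assumes "cubic G" "three_array G M"
  shows "card (uncovered G M) =
    card {e \<in> edges G. cover_count M e = 2} + 2 * card {e \<in> edges G. cover_count M e = 3}"
proof -
  have fin: "finite (edges G)" using assms(1) unfolding cubic_def wf_graph_def by auto
  \<comment> \<open>The cover count takes only the values 0 to 3; the identity holds for each of
    them and is then summed over all edges.\<close>
  have eq: "1 + of_bool (cover_count M e = 2) + 2 * of_bool (cover_count M e = 3)
        = cover_count M e + of_bool (cover_count M e = 0)" for e
    using cover_count_le_3[of M e] by (auto simp: le_Suc_eq eval_nat_numeral)
  have "(\<Sum>e\<in>edges G. 1 + of_bool (cover_count M e = 2) + 2 * of_bool (cover_count M e = 3))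
     = (\<Sum>e\<in>edges G. cover_count M e + of_bool (cover_count M e = 0))"
    by (intro sum.cong eq refl)
  then show ?thesis using fin sum_cover_count[OF assms] unfolding sum.distrib
    by (simp add: uncovered_def sum_distrib_left[symmetric] Int_def)
qed

lemma cover_count_3_iff: "cover_count M e = 3 \<longleftrightarrow> (\<forall>i<3. e \<in> M i)"
  unfolding cover_count_eq by (auto simp: eval_nat_numeral less_Suc_eq)

lemma cover_count_0_iff: "cover_count M e = 0 \<longleftrightarrow> (\<forall>i<3. e \<notin> M i)"
  unfolding cover_count_eq by (auto simp: eval_nat_numeral less_Suc_eq)

text \<open>In an uncolourable graph any two of the three matchings share an edge, as the classes
  \<open>M i\<close>, \<open>M j\<close> and their complement would otherwise be a colouring.\<close>

lemma array_without_triple_edge: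
  assumes "cubic G" "loopless G" "\<not> colourable3 G" "three_array G M"
    and "card (uncovered G M) \<le> 3"
    and no3: "\<And>e. e \<in> edges G \<Longrightarrow> cover_count M e \<noteq> 3"
  shows "card (uncovered G M) = 3"
    and "\<exists>d. {e \<in> edges G. cover_count M e = 2} = d ` {..<3} \<and>
      (\<forall>k<3. \<forall>i<3. d k \<in> M i \<longleftrightarrow> i \<noteq> k)"
proof -
  have fin: "finite (edges G)" using assms(1) unfolding cubic_def wf_graph_def by auto
  have pm: "perfect_matching G (M i)" if "i < 3" for i using assms(4) that unfolding three_array_def by auto
  then have sub: "M i \<subseteq> edges G" if "i < 3" for i using that unfolding perfect_matching_def by auto
  let ?D = "{e \<in> edges G. cover_count M e = 2}"
  \<comment> \<open>The witness \<open>d\<close> is a common edge of the two matchings other than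
    \<open>M k\<close>. It avoids \<open>M k\<close> because no edge lies in all three.\<close>
  have "\<exists>d. d \<in> ?D \<and> (\<forall>i<3. d \<in> M i \<longleftrightarrow> i \<noteq> k)" if k: "k < 3" for k
  proof -
    obtain i j where ij: "i < 3" "j < 3" "i \<noteq> j" "i \<noteq> k" "j \<noteq> k"
      using k that[of 1 2] that[of 0 2] that[of 0 1] by (auto simp: eval_nat_numeral less_Suc_eq)
    have all: "l = i \<or> l = j \<or> l = k" if "l < 3" for l using ij k that by linarith
    obtain d where d: "d \<in> M i" "d \<in> M j"
      using disjoint_matchings_colourable3[OF assms(1,2) pm[OF ij(1)] pm[OF ij(2)]] assms(3) by blast
    have "d \<in> edges G" using d sub ij by blast
    moreover have "d \<notin> M k"
      using no3[OF calculation] d all unfolding cover_count_3_iff by blast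
    moreover have "{l. l < 3 \<and> d \<in> M l} = {i, j}" using ij d all calculation by auto
    then have "cover_count M d = 2" unfolding cover_count_def using ij by simp
    ultimately show ?thesis using ij d all by (intro exI[of _ d]) auto
  qed
  then obtain d where d: "\<And>k. k < 3 \<Longrightarrow> d k \<in> ?D" "\<And>k i. k < 3 \<Longrightarrow> i < 3 \<Longrightarrow> d k \<in> M i \<longleftrightarrow> i \<noteq> k"
    by metis
  have "inj_on d {..<3}"
  proof (rule inj_onI)
    fix k l :: nat assume "k \<in> {..<3}" "l \<in> {..<3}" "d k = d l"
    then show "k = l" using d(2)[of k k] d(2)[of l k] by auto
  qed
  then have c3: "card (d ` {..<3}) = 3" by (simp add: card_image)
  have dsub: "d ` {..<3} \<subseteq> ?D" using d(1) by auto
  have "{e \<in> edges G. cover_count M e = 3} = {}" using no3 by blast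
  \<comment> \<open>Without triple edges the balance gives as many double edges as uncovered ones.
    Three distinct edges \<open>d k\<close> and at most three uncovered edges then leave room for no
    other double edge.\<close>
  then have cD: "card ?D = card (uncovered G M)"
    using cover_count_balance[OF assms(1,4)] by (metis (no_types) card.empty mult_0_right add_0_right)
  have "card (d ` {..<3}) \<le> card ?D" using dsub fin by (intro card_mono) auto
  then show "card (uncovered G M) = 3" using cD c3 assms(5) by simp
  then have "card ?D = 3" using cD by simp
  then have "d ` {..<3} = ?D" using card_subset_eq[OF _ dsub] c3 fin by simp
  then show "\<exists>d. ?D = d ` {..<3} \<and> (\<forall>k<3. \<forall>i<3. d k \<in> M i \<longleftrightarrow> i \<noteq> k)"
    using d(2) by blast
qed

text \<open>All other edges at the two ends of a triple edge \<open>e\<close> are uncovered. Two at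
  each end, but at most three in total, force a common one \<open>f\<close>, which is parallel to
  \<open>e\<close>. Replacing \<open>e\<close> by \<open>f\<close> in one matching yields an array
  without triple edges but with fewer than three uncovered edges, contrary to
  \<open>array_without_triple_edge\<close>.\<close>

lemma no_triple_edge:
  assumes "cubic G" "loopless G" "\<not> colourable3 G" "three_array G M"
    and "card (uncovered G M) \<le> 3" "e \<in> edges G"
  shows "cover_count M e \<noteq> 3"
proof
  assume e3: "cover_count M e = 3"
  then have eM: "\<And>i. i < 3 \<Longrightarrow> e \<in> M i" unfolding cover_count_3_iff by blast
  have wf: "wf_graph G" and fin: "finite (edges G)" using assms(1) unfolding cubic_def wf_graph_def by auto
  have finU: "finite (uncovered G M)" using fin unfolding uncovered_def by auto
  have pm: "perfect_matching G (M i)" if "i < 3" for i using assms(4) that unfolding three_array_def by auto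
  obtain x y where xy: "ends G e = {#x, y#}" "x \<noteq> y" "x \<in> verts G" "y \<in> verts G"
    using ends_pair_cases[OF wf assms(2,6)] .
  have unc: "inc_edges G z - {e} \<subseteq> uncovered G M" if z: "z \<in> {x, y}" for z
  proof
    fix f assume f: "f \<in> inc_edges G z - {e}"
    have "f \<notin> M i" if "i < 3" for i
      using matching_unique[OF wf assms(2) pm[OF that], of z f e] f eM[OF that] xy z
      unfolding inc_edges_def by auto
    then show "f \<in> uncovered G M"
      using f unfolding uncovered_def cover_count_0_iff inc_edges_def by auto
  qed
  have two: "card (inc_edges G z - {e}) = 2" if "z \<in> {x, y}" for z
    using card_inc_edges[OF assms(1,2), of z] xy that assms(6) by (auto simp: inc_edges_def)
  have "(inc_edges G x - {e}) \<inter> (inc_edges G y - {e}) \<noteq> {}"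
  proof
    assume "(inc_edges G x - {e}) \<inter> (inc_edges G y - {e}) = {}"
    then have "card ((inc_edges G x - {e}) \<union> (inc_edges G y - {e})) = 4"
      using two[of x] two[of y] finite_inc_edges[OF wf] by (simp add: card_Un_disjoint)
    moreover have "card ((inc_edges G x - {e}) \<union> (inc_edges G y - {e})) \<le> card (uncovered G M)"
      using unc finU by (intro card_mono) auto
    ultimately show False using assms(5) by simp
  qed
  then obtain f where f: "f \<in> inc_edges G x" "f \<in> inc_edges G y" "f \<noteq> e" by blast
  have fU: "f \<in> uncovered G M" using unc[of x] f by auto
  then have fE: "f \<in> edges G" and fM: "\<And>i. i < 3 \<Longrightarrow> f \<notin> M i"
    unfolding uncovered_def cover_count_0_iff by auto
  have "ends G f = ends G e"
    using ends_eq_pair_of_mem[OF wf assms(2) fE, of x y] f xy by (auto simp: inc_edges_def)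
  then have "perfect_matching G (insert f (M 0 - {e}))"
    using swap_parallel_edge[OF wf assms(2) pm[of 0] eM[of 0] fE fM[of 0]] by simp
  then have arr: "three_array G (M(0 := insert f (M 0 - {e})))" (is "three_array G ?N")
    using pm unfolding three_array_def by auto
  have N: "cover_count ?N g = (if g = e then 2 else if g = f then 1 else cover_count M g)" for g
    using eM[of 0] eM[of 1] eM[of 2] fM[of 0] fM[of 1] fM[of 2] f(3)
    unfolding cover_count_eq by (auto simp: eval_nat_numeral)
  have "uncovered G ?N = uncovered G M - {f}" unfolding uncovered_def N using e3 by auto
  then have lt: "card (uncovered G ?N) < card (uncovered G M)"
    using fU finU by (metis card_Diff1_less)
  \<comment> \<open>A triple edge accounts for two uncovered edges in the balance, so
    \<open>e\<close> is the only one and the new array has none.\<close>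
  have "card {g \<in> edges G. cover_count M g = 3} \<le> 1"
    using cover_count_balance[OF assms(1,4)] assms(5) by linarith
  then have "\<And>g. g \<in> edges G \<Longrightarrow> cover_count M g = 3 \<Longrightarrow> g = e"
    using e3 assms(6) fin by (auto simp: card_le_Suc0_iff_eq)
  then have "\<And>g. g \<in> edges G \<Longrightarrow> cover_count ?N g \<noteq> 3" unfolding N by auto
  then have "card (uncovered G ?N) = 3"
    using array_without_triple_edge(1)[OF assms(1-3) arr] lt assms(5) by simp
  then show False using lt assms(5) by simp
qed

text \<open>With triple edges excluded, multiply covered means covered exactly twice. The first
  claim also supplies the lower bound for the defect; the labelling \<open>d\<close> in the second
  is the starting point for tracing the hexagon.\<close>

lemma array_structure:
  assumes "cubic G" "loopless G" "\<not> colourable3 G" "three_array G M"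
    and "card (uncovered G M) \<le> 3"
  shows "card (uncovered G M) = 3"
    and "\<exists>d. {e \<in> edges G. cover_count M e \<ge> 2} = d ` {..<3} \<and>
      (\<forall>k<3. \<forall>i<3. d k \<in> M i \<longleftrightarrow> i \<noteq> k)"
proof -
  note no3 = no_triple_edge[OF assms]
  have "{e \<in> edges G. cover_count M e = 2} = {e \<in> edges G. cover_count M e \<ge> 2}"
    using no3 cover_count_le_3[of M] by (force simp: le_Suc_eq eval_nat_numeral)
  then show "card (uncovered G M) = 3"
    and "\<exists>d. {e \<in> edges G. cover_count M e \<ge> 2} = d ` {..<3} \<and>
      (\<forall>k<3. \<forall>i<3. d k \<in> M i \<longleftrightarrow> i \<noteq> k)"
    using array_without_triple_edge[OF assms no3] by auto
qed

section \<open>Inflating a vertex to a triangle\<close>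

lemma verts_inflate: "verts (inflate G v) = Inl ` (verts G - {v}) \<union> Inr ` inc_edges G v"
  by (simp add: inflate_def)

lemma Inl_in_edges_inflate: "Inl e \<in> edges (inflate G v) \<longleftrightarrow> e \<in> edges G"
  by (auto simp: inflate_def)

lemma Inr_in_edges_inflate: "Inr s \<in> edges (inflate G v) \<longleftrightarrow>
    (\<exists>e1 e2. s = {e1, e2} \<and> e1 \<in> inc_edges G v \<and> e2 \<in> inc_edges G v \<and> e1 \<noteq> e2)"
  by (auto simp: inflate_def)

lemma ends_inflate_Inl:
  "ends (inflate G v) (Inl e) = image_mset (\<lambda>x. if x = v then Inr e else Inl x) (ends G e)"
  by (simp add: inflate_def)

lemma ends_inflate_Inr: "ends (inflate G v) (Inr s) = image_mset Inr (mset_set s)"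
  by (simp add: inflate_def)

lemma mem_ends_inflate:
  "Inl x \<in># ends (inflate G v) (Inl e) \<longleftrightarrow> x \<noteq> v \<and> x \<in># ends G e"
  "Inr f \<in># ends (inflate G v) (Inl e) \<longleftrightarrow> f = e \<and> v \<in># ends G e"
  "Inl x \<notin># ends (inflate G v) (Inr s)"
  "finite s \<Longrightarrow> Inr f \<in># ends (inflate G v) (Inr s) \<longleftrightarrow> f \<in> s"
  by (auto simp: ends_inflate_Inl ends_inflate_Inr image_iff)

lemma inc_edges_inflate_Inl:
  assumes "x \<noteq> v"
  shows "inc_edges (inflate G v) (Inl x) = Inl ` inc_edges G x"
proof (rule set_eqI)
  fix f show "f \<in> inc_edges (inflate G v) (Inl x) \<longleftrightarrow> f \<in> Inl ` inc_edges G x"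
    using assms by (cases f) (auto simp: inc_edges_def mem_ends_inflate Inl_in_edges_inflate)
qed

lemma inc_edges_inflate_Inr:
  assumes "inc_edges G v = {a, b, c}" "distinct [a, b, c]"
  shows "inc_edges (inflate G v) (Inr a) = {Inl a, Inr {a, b}, Inr {a, c}}"
proof (rule set_eqI)
  fix f
  have a: "a \<in> edges G" "v \<in># ends G a" using assms(1) unfolding inc_edges_def by auto
  show "f \<in> inc_edges (inflate G v) (Inr a) \<longleftrightarrow> f \<in> {Inl a, Inr {a, b}, Inr {a, c}}"
  proof (cases f)
    case (Inl e)
    then show ?thesis using a
      by (auto simp: inc_edges_def mem_ends_inflate Inl_in_edges_inflate)
  next
    case (Inr s)
    have "f \<in> inc_edges (inflate G v) (Inr a) \<longleftrightarrow>
      (\<exists>e1 e2. s = {e1, e2} \<and> e1 \<in> {a,b,c} \<and> e2 \<in> {a,b,c} \<and> e1 \<noteq> e2) \<and> a \<in> s"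
      unfolding inc_edges_def[of "inflate G v"] Inr mem_Collect_eq Inr_in_edges_inflate assms(1)
      by (auto simp: mem_ends_inflate)
    also have "\<dots> \<longleftrightarrow> s = {a, b} \<or> s = {a, c}" using assms(2) by auto
    finally show ?thesis using Inr by simp
  qed
qed

lemma wf_inflate:
  assumes "wf_graph G" "v \<in> verts G"
  shows "wf_graph (inflate G v)"
  unfolding wf_graph_def
proof (intro conjI ballI)
  have fin: "finite (verts G)" "finite (edges G)" using assms unfolding wf_graph_def by auto
  have fi: "finite (inc_edges G v)" using finite_inc_edges[OF assms(1)] .
  show "finite (verts (inflate G v))" using fin fi by (simp add: verts_inflate)
  have "{{e1, e2} | e1 e2. e1 \<in> inc_edges G v \<and> e2 \<in> inc_edges G v \<and> e1 \<noteq> e2} \<subseteq> Pow (inc_edges G v)"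
    by auto
  then have "finite {{e1, e2} | e1 e2. e1 \<in> inc_edges G v \<and> e2 \<in> inc_edges G v \<and> e1 \<noteq> e2}"
    by (rule finite_subset) (use fi in simp)
  then show "finite (edges (inflate G v))" using fin by (simp add: inflate_def)
  fix f assume f: "f \<in> edges (inflate G v)"
  show "size (ends (inflate G v) f) = 2"
  proof (cases f)
    case (Inl e)
    then show ?thesis using f assms(1) unfolding wf_graph_def
      by (simp add: ends_inflate_Inl Inl_in_edges_inflate)
  next
    case (Inr s)
    then show ?thesis using f by (auto simp: ends_inflate_Inr Inr_in_edges_inflate)
  qed
  show "set_mset (ends (inflate G v) f) \<subseteq> verts (inflate G v)"
  proof (cases f)
    case (Inl e)
    then have "e \<in> edges G" using f by (simp add: Inl_in_edges_inflate)
    then have "set_mset (ends G e) \<subseteq> verts G" using assms(1) unfolding wf_graph_def by auto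
    then show ?thesis using Inl \<open>e \<in> edges G\<close>
      by (auto simp: ends_inflate_Inl verts_inflate inc_edges_def split: if_splits)
  next
    case (Inr s)
    then show ?thesis using f
      by (auto simp: ends_inflate_Inr Inr_in_edges_inflate verts_inflate)
  qed
qed

lemma loopless_inflate:
  assumes "wf_graph G" "loopless G"
  shows "loopless (inflate G v)"
  unfolding loopless_def
proof (intro ballI allI)
  fix f y assume f: "f \<in> edges (inflate G v)"
  show "count (ends (inflate G v) f) y \<le> 1"
  proof (cases f)
    case (Inl e)
    then have "e \<in> edges G" using f by (simp add: Inl_in_edges_inflate)
    then obtain p q where "ends G e = {#p, q#}" "p \<noteq> q" using ends_pair_cases[OF assms] by metis
    then show ?thesis using Inl by (auto simp: ends_inflate_Inl)
  next
    case (Inr s)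
    then show ?thesis using f by (auto simp: ends_inflate_Inr Inr_in_edges_inflate)
  qed
qed

lemma inc_edges_at_vertex:
  assumes "cubic G" "loopless G" "v \<in> verts G" "a \<in> inc_edges G v"
  obtains b c where "inc_edges G v = {a, b, c}" "distinct [a, b, c]"
proof -
  have "card (inc_edges G v - {a}) = 2"
    using card_inc_edges[OF assms(1-3)] assms(4) by simp
  then obtain b c where "inc_edges G v - {a} = {b, c}" "b \<noteq> c" by (meson card_2_iff)
  then show thesis using that[of b c] assms(4) by auto
qed

lemma cubic_inflate:
  assumes "cubic G" "loopless G" "v \<in> verts G"
  shows "cubic (inflate G v)"
proof -
  have wf: "wf_graph G" using assms(1) unfolding cubic_def by simp
  note wH = wf_inflate[OF wf assms(3)] and lH = loopless_inflate[OF wf assms(2), of v]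
  have "card (inc_edges (inflate G v) x) = 3" if x: "x \<in> verts (inflate G v)" for x
  proof (cases x)
    case (Inl y)
    then have y: "y \<noteq> v" "y \<in> verts G" using x by (auto simp: verts_inflate)
    then show ?thesis using card_inc_edges[OF assms(1,2) y(2)]
      by (simp add: Inl inc_edges_inflate_Inl card_image)
  next
    case (Inr a)
    then have "a \<in> inc_edges G v" using x by (auto simp: verts_inflate)
    then obtain b c where bc: "inc_edges G v = {a, b, c}" "distinct [a, b, c]"
      using inc_edges_at_vertex[OF assms] by metis
    then have "{a, b} \<noteq> {a, c}" by auto
    then show ?thesis unfolding Inr inc_edges_inflate_Inr[OF bc] by simp
  qed
  then show ?thesis using wH lH unfolding cubic_def by (simp add: deg_in_edges)
qed

text \<open>Contracting the triangle turns a colouring of the inflated graph into one of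
  \<open>G\<close>. The three triangle edges have distinct colours, and each attached edge repeats
  the colour of the opposite triangle edge.\<close>

lemma inflate_not_colourable3:
  assumes "cubic G" "loopless G" "v \<in> verts G" "\<not> colourable3 G"
  shows "\<not> colourable3 (inflate G v)"
proof
  have wf: "wf_graph G" using assms(1) unfolding cubic_def by simp
  note wH = wf_inflate[OF wf assms(3)] and lH = loopless_inflate[OF wf assms(2), of v]
  assume "colourable3 (inflate G v)"
  then obtain k :: "_ \<Rightarrow> nat" where k: "\<And>f. f \<in> edges (inflate G v) \<Longrightarrow> k f < 3"
    "\<And>x. x \<in> verts (inflate G v) \<Longrightarrow> inj_on k (inc_edges (inflate G v) x)"
    unfolding colourable3_def proper_3_edge_colouring_iff[OF wH lH] by blast
  define c where "c e = k (Inl e)" for e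
  have lt: "c e < 3" if "e \<in> edges G" for e
    unfolding c_def using k(1) that by (simp add: Inl_in_edges_inflate)
  have "inj_on c (inc_edges G x)" if x: "x \<in> verts G" for x
  proof (cases "x = v")
    case False
    then have "inj_on k (Inl ` inc_edges G x)"
      using k(2)[of "Inl x"] x by (simp add: inc_edges_inflate_Inl verts_inflate)
    then show ?thesis by (auto simp: c_def inj_on_def)
  next
    case True
    \<comment> \<open>With \<open>e\<close> the third edge at \<open>v\<close>, the edge
      \<open>Inl a\<close> has the colour of \<open>Inr {b, e}\<close> and \<open>Inl b\<close> that
      of \<open>Inr {a, e}\<close>.\<close>
    have "c a \<noteq> c b" if ab: "a \<in> inc_edges G v" "b \<in> inc_edges G v" "a \<noteq> b" for a b
    proof -
      obtain e where e: "inc_edges G v = {a, b, e}" "e \<noteq> a" "e \<noteq> b"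
        using third_edge[OF assms(1-3) ab] .
      have I: "inj_on k {Inl a, Inr {a, b}, Inr {a, e}}" "inj_on k {Inl b, Inr {b, a}, Inr {b, e}}"
        "inj_on k {Inl e, Inr {e, a}, Inr {e, b}}"
        using k(2)[of "Inr a"] k(2)[of "Inr b"] k(2)[of "Inr e"] e ab(3)
          inc_edges_inflate_Inr[of G v a b e] inc_edges_inflate_Inr[of G v b a e]
          inc_edges_inflate_Inr[of G v e a b]
        by (auto simp: verts_inflate insert_commute)
      have n: "{a, b} \<noteq> {a, e}" "{a, b} \<noteq> {b, e}" "{a, e} \<noteq> {b, e}" using e ab(3) by auto
      have "Inr {a, b} \<in> edges (inflate G v)" "Inr {a, e} \<in> edges (inflate G v)" 
        "Inr {b, e} \<in> edges (inflate G v)"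
        unfolding Inr_in_edges_inflate using e ab by blast+
      then have "k (Inr {a, b}) < 3" "k (Inr {a, e}) < 3" "k (Inr {b, e}) < 3"
        "k (Inl a) < 3" "k (Inl b) < 3"
        using k(1) lt[unfolded c_def] ab by (auto simp: inc_edges_def)
      moreover have "k (Inl a) \<noteq> k (Inr {a, b})" "k (Inl a) \<noteq> k (Inr {a, e})"
        "k (Inl b) \<noteq> k (Inr {a, b})" "k (Inl b) \<noteq> k (Inr {b, e})"
        "k (Inr {a, b}) \<noteq> k (Inr {a, e})" "k (Inr {a, b}) \<noteq> k (Inr {b, e})"
        "k (Inr {a, e}) \<noteq> k (Inr {b, e})"
        using I n by (auto simp: insert_commute)
      ultimately show ?thesis unfolding c_def by linarith
    qed
    then show ?thesis using True by (auto simp: inj_on_def)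
  qed
  then have "proper_3_edge_colouring G c"
    using lt unfolding proper_3_edge_colouring_iff[OF wf assms(2)] by blast
  then show False using assms(4) unfolding colourable3_def by blast
qed

section \<open>From a hexagonal core to a heavy pentagon\<close>

text \<open>The setting in which the core is traced: an array with the labelling of its multiply
  covered edges that \<open>array_structure\<close> provides. The two matchings other than
  \<open>M k\<close> share the edge \<open>d k\<close>.\<close>

locale defect_3_array =
  fixes H :: "('v, 'e) mgraph" and M :: "nat \<Rightarrow> 'e set" and d :: "nat \<Rightarrow> 'e"
  assumes cubic: "cubic H" and ll: "loopless H" and not_colourable3: "\<not> colourable3 H"
    and array: "three_array H M"
    and doubles: "{e \<in> edges H. cover_count M e \<ge> 2} = d ` {..<3}"
    and d_mem: "\<And>k i. k < 3 \<Longrightarrow> i < 3 \<Longrightarrow> d k \<in> M i \<longleftrightarrow> i \<noteq> k"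
begin

lemma wf: "wf_graph H" using cubic unfolding cubic_def by simp

lemma matching: "i < 3 \<Longrightarrow> perfect_matching H (M i)"
  using array unfolding three_array_def by simp

lemma matching_sub: "i < 3 \<Longrightarrow> e \<in> M i \<Longrightarrow> e \<in> edges H"
  using matching unfolding perfect_matching_def by blast

lemma d_edge: "k < 3 \<Longrightarrow> d k \<in> edges H" using doubles by blast

lemma end_in_verts: "e \<in> edges H \<Longrightarrow> x \<in># ends H e \<Longrightarrow> x \<in> verts H"
  using wf unfolding wf_graph_def by blast

lemma uniq:
  assumes "i < 3" "m \<in> M i" "n \<in> M i" "x \<in># ends H m" "x \<in># ends H n"
  shows "m = n"
  using matching_unique[OF wf ll matching[OF assms(1)] end_in_verts assms(2-5)]
    matching_sub[OF assms(1,2)] assms(4) by blast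

lemma double_eq:
  assumes "i < 3" "j < 3" "i \<noteq> j" "e \<in> M i" "e \<in> M j"
  obtains k where "k < 3" "e = d k"
proof -
  have "{i, j} \<subseteq> {l. l < 3 \<and> e \<in> M l}" using assms by auto
  then have "card {i, j} \<le> cover_count M e" unfolding cover_count_def by (intro card_mono) auto
  then have "e \<in> d ` {..<3}" using assms matching_sub doubles[symmetric] by auto
  then show thesis using that by auto
qed

section \<open>Local structure of the core\<close>

abbreviation unc :: "'e \<Rightarrow> bool" where
  "unc u \<equiv> u \<in> edges H \<and> (\<forall>i<3. u \<notin> M i)"

lemma third_index:
  assumes "k < 3" "l < (3::nat)"
  obtains i where "i < 3" "i \<noteq> k" "i \<noteq> l"
proof -
  have "\<exists>i<3. i \<noteq> k \<and> i \<noteq> l" using assms by presburger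
  then show thesis using that by blast
qed

text \<open>Each of the three matchings needs an edge at \<open>x\<close>, but only two edges
  besides \<open>u\<close> are available there. So two matchings share an edge at \<open>x\<close>,
  and a shared edge is some \<open>d k\<close>.\<close>

lemma unc_end:
  assumes "unc u" "x \<in># ends H u"
  obtains k where "k < 3" "x \<in># ends H (d k)"
proof -
  have x: "x \<in> verts H" using assms end_in_verts by blast
  have "\<exists>m. m \<in> M i \<and> m \<in> inc_edges H x" if "i < 3" for i
    using matched_edge[OF wf ll matching[OF that] x] by blast
  then obtain m where m: "\<And>i. i < 3 \<Longrightarrow> m i \<in> M i \<and> m i \<in> inc_edges H x" by metis
  have "card (inc_edges H x - {u}) = 2"
    using card_inc_edges[OF cubic ll x] assms by (simp add: inc_edges_def)
  moreover have "m ` {..<3} \<subseteq> inc_edges H x - {u}" using m assms(1) by auto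
  ultimately have "card (m ` {..<3}) \<le> 2"
    using finite_inc_edges[OF wf] by (metis card_mono finite_Diff)
  then have "\<not> inj_on m {..<3}" using card_image by fastforce
  then obtain i j where ij: "i < 3" "j < 3" "i \<noteq> j" "m i = m j" unfolding inj_on_def by auto
  then have "m i \<in> M i" "m i \<in> M j" using m by metis+
  then obtain k where "k < 3" "m i = d k" using double_eq ij by metis
  then show thesis using that[of k] m[OF ij(1)] unfolding inc_edges_def by auto
qed

text \<open>The edge \<open>d k\<close> serves both matchings other than \<open>M k\<close> at
  \<open>x\<close>, and a second edge \<open>s\<close> serves \<open>M k\<close>. Nothing is left to
  cover the third edge.\<close>

lemma double_end:
  assumes "k < 3" "x \<in># ends H (d k)"
  obtains s u where "inc_edges H x = {d k, s, u}" "distinct [d k, s, u]" "s \<in> M k" "unc u"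
proof -
  have x: "x \<in> verts H" using end_in_verts d_edge assms by blast
  obtain s where s: "s \<in> inc_edges H x" "s \<in> M k"
    using matched_edge[OF wf ll matching[OF assms(1)] x] by blast
  have ne: "s \<noteq> d k" using s(2) d_mem assms(1) by blast
  have dk: "d k \<in> inc_edges H x" using d_edge assms unfolding inc_edges_def by blast
  obtain u where u: "inc_edges H x = {d k, s, u}" "u \<noteq> d k" "u \<noteq> s"
    using third_edge[OF cubic ll x dk s(1)] ne by metis
  then have ux: "u \<in> edges H" "x \<in># ends H u" "x \<in># ends H s"
    unfolding inc_edges_def by blast+
  have "u \<notin> M i" if "i < 3" for i
    using uniq[OF that, of u s x] uniq[OF that, of u "d k" x] u ux assms s d_mem[OF assms(1) that]
    by blast
  then show thesis using that[of s u] u ux ne s by auto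
qed

text \<open>Some \<open>M i\<close> with \<open>i\<close> different from \<open>k\<close> and
  \<open>l\<close> contains both edges, so a common end makes them equal. The label is then
  determined, as \<open>M k\<close> is the only matching missing \<open>d k\<close>.\<close>

lemma double_unique:
  assumes "k < 3" "l < 3" "x \<in># ends H (d k)" "x \<in># ends H (d l)"
  shows "k = l"
proof -
  obtain i where i: "i < 3" "i \<noteq> k" "i \<noteq> l" using third_index assms by metis
  have "d k = d l" using uniq[OF i(1), of "d k" "d l" x] i assms d_mem by auto
  then show ?thesis using d_mem[OF assms(1,1)] d_mem[OF assms(2,1)] by auto
qed

lemma unc_unique:
  assumes "unc u" "unc w" "x \<in># ends H u" "x \<in># ends H w"
  shows "u = w"
proof -
  obtain k where k: "k < 3" "x \<in># ends H (d k)" using unc_end assms by metis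
  obtain s z where z: "inc_edges H x = {d k, s, z}" "s \<in> M k"
    using double_end[OF k] by metis
  obtain i where i: "i < 3" "i \<noteq> k" using third_index k by metis
  have "u \<in> {d k, s, z}" "w \<in> {d k, s, z}" using z(1) assms unfolding inc_edges_def by auto
  moreover have "d k \<in> M i" using d_mem k i by simp
  ultimately show ?thesis using assms(1,2) z(2) k(1) i by auto
qed

text \<open>The two matchings other than \<open>M k\<close> have only \<open>d k\<close> in common.
  Replacing it in one of them by a parallel uncovered edge would make them disjoint and the graph
  colourable.\<close>

lemma unc_not_parallel:
  assumes "unc u" "k < 3" "x \<in># ends H u" "y \<in># ends H u" "x \<noteq> y"
    "x \<in># ends H (d k)" "y \<in># ends H (d k)"
  shows False
proof -
  have par: "ends H u = ends H (d k)"
    using ends_eq_pair_of_mem[OF wf ll _ _ _ assms(5)] assms d_edge by metis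
  obtain i where i: "i < 3" "i \<noteq> k" using third_index assms(2) by metis
  obtain j where j: "j < 3" "j \<noteq> k" "j \<noteq> i" using third_index assms(2) i by metis
  have di: "d k \<in> M i" using d_mem assms(2) i by simp
  have "insert u (M i - {d k}) \<inter> M j = {}"
  proof (rule ccontr)
    assume "insert u (M i - {d k}) \<inter> M j \<noteq> {}"
    then obtain e where e: "e \<in> M i" "e \<in> M j" "e \<noteq> d k" using assms(1) j by auto
    obtain l where l: "l < 3" "e = d l" using double_eq[of i j e] i j e by metis
    then have "l \<noteq> i" "l \<noteq> j" using e d_mem i j by auto
    then have "l = k" using l(1) i j assms(2) by linarith
    then show False using l e by simp
  qed
  then show False
    using disjoint_matchings_colourable3[OF cubic ll swap_parallel_edge[OF wf ll matching[OF i(1)] di]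
      matching[OF j(1)]] par assms(1) i not_colourable3 by blast
qed

end

text \<open>The hexagon is traced through \<open>Inr a\<close>, \<open>Inl p\<close>,
  \<open>Inl y\<close>, \<open>Inl z\<close>, \<open>Inl q\<close>, \<open>Inr b\<close>. Its double
  edges are \<open>d i\<close> = \<open>Inl a\<close>, \<open>d k\<close> = \<open>Inl g\<close> and
  \<open>d j\<close> = \<open>Inl b\<close>; its uncovered edges are \<open>u1\<close>,
  \<open>u2\<close> and the triangle edge \<open>Inr {a, b}\<close>. The edge \<open>e\<close> is
  the third one at \<open>v\<close>.\<close>

lemma hexagonal_core_imp_heavy_pentagon:
  fixes G :: "('v, 'e) mgraph"
  assumes G: "cubic G" "loopless G" "\<not> colourable3 G" and v: "v \<in> verts G"
    and arr: "three_array (inflate G v) M" and c3: "card (uncovered (inflate G v) M) = 3"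
    and core: "core_verts (inflate G v) M \<inter> triangle G v \<noteq> {}"
  shows "on_heavy_pentagon G v"
proof -
  define H where "H = inflate G v"
  have wfG: "wf_graph G" using G(1) unfolding cubic_def by simp
  have H: "cubic H" "loopless H" "\<not> colourable3 H"
    unfolding H_def using cubic_inflate[OF G(1,2) v] loopless_inflate[OF wfG G(2)]
      inflate_not_colourable3[OF G(1,2) v G(3)] by simp_all
  obtain d where "{e \<in> edges H. cover_count M e \<ge> 2} = d ` {..<3}"
      "\<forall>k<3. \<forall>i<3. d k \<in> M i \<longleftrightarrow> i \<noteq> k"
    using array_structure(2)[OF H arr[folded H_def]] c3 unfolding H_def by auto
  then interpret defect_3_array H M d
    using H arr by unfold_locales (auto simp: H_def)
  have incr: "inc_edges H (Inr a) = {Inl a, Inr {a, b}, Inr {a, c}}"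
    if "inc_edges G v = {a, b, c}" "distinct [a, b, c]" for a b c
    unfolding H_def using inc_edges_inflate_Inr[OF that] .
  have inc_iff: "e \<in> inc_edges H x \<longleftrightarrow> e \<in> edges H \<and> x \<in># ends H e" for e x
    unfolding inc_edges_def by simp

  \<comment> \<open>An uncovered edge of the triangle\<close>
  have "\<exists>a b. a \<in> inc_edges G v \<and> b \<in> inc_edges G v \<and> a \<noteq> b \<and> unc (Inr {a, b})"
  proof -
    obtain a f where af: "a \<in> inc_edges G v" "f \<in> edges H" "cover_count M f \<noteq> 1" "Inr a \<in># ends H f"
      using core unfolding core_verts_def core_edges_def triangle_def H_def by auto
    obtain k where k: "k < 3" "Inr a \<in># ends H (d k)"
    proof (cases "cover_count M f = 0")
      case True
      then have "unc f" using af(2) unfolding cover_count_0_iff by blast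
      then show thesis using unc_end[OF _ af(4)] that by blast
    next
      case False
      then have "f \<in> {e \<in> edges H. cover_count M e \<ge> 2}" using af by auto
      then show thesis using af(4) that unfolding doubles by auto
    qed
    obtain s u where su: "inc_edges H (Inr a) = {d k, s, u}" "distinct [d k, s, u]" "s \<in> M k" "unc u"
      using double_end[OF k] by metis
    \<comment> \<open>Suppose the double edge at \<open>Inr a\<close> is a triangle edge
      \<open>Inr {a, b}\<close>. If neither \<open>Inr {a, c}\<close> nor \<open>Inr {b, c}\<close>
      were uncovered, both would lie in \<open>M k\<close> and meet at \<open>Inr c\<close>.\<close>
    have *: ?thesis if bc: "inc_edges G v = {a, b, c}" "distinct [a, b, c]"
      and db: "d k = Inr {a, b}" for b c
    proof (cases "u = Inr {a, c}")
      case True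
      then show ?thesis using su(4) bc by auto
    next
      case False
      have "Inr {a, c} \<noteq> d k" using db bc(2) by auto
      then have s: "Inr {a, c} = s" using su(1) incr[OF bc] False by blast
      have b': "inc_edges H (Inr b) = {Inl b, Inr {b, a}, Inr {b, c}}"
        by (rule incr) (use bc in auto)
      have "Inr b \<in># ends H (d k)" unfolding db by (simp add: H_def mem_ends_inflate)
      then obtain s' u' where su': "inc_edges H (Inr b) = {d k, s', u'}" "s' \<in> M k" "unc u'"
        using double_end[OF k(1)] by metis
      have "Inr {b, c} \<noteq> d k" using db bc(2) by auto
      then consider "Inr {b, c} = s'" | "Inr {b, c} = u'" using su'(1) b' by blast
      then show ?thesis
      proof cases
        case 1
        have "Inr c \<in># ends H (Inr {a, c})" "Inr c \<in># ends H (Inr {b, c})"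
          by (simp_all add: H_def mem_ends_inflate)
        then have "Inr {a, c} = (Inr {b, c} :: 'e + 'e set)"
          using uniq[OF k(1)] s su(3) 1 su'(2) by blast
        then show ?thesis using bc(2) by auto
      next
        case 2
        then show ?thesis using su'(3) bc by auto
      qed
    qed
    obtain b c where bc: "inc_edges G v = {a, b, c}" "distinct [a, b, c]"
      using inc_edges_at_vertex[OF G(1,2) v af(1)] .
    have bc': "inc_edges G v = {a, c, b}" "distinct [a, c, b]" using bc by auto
    have eq: "{d k, s, u} = {Inl a, Inr {a, b}, Inr {a, c}}" using su(1) incr[OF bc] by simp
    then consider "d k = Inr {a, b}" | "d k = Inr {a, c}" | "d k = Inl a" by blast
    then show ?thesis
    proof cases
      case 1
      then show ?thesis by (rule *[OF bc])
    next
      case 2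
      then show ?thesis by (rule *[OF bc'])
    next
      case 3
      have "u \<in> {Inl a, Inr {a, b}, Inr {a, c}}" using eq by blast
      then have "u = Inr {a, b} \<or> u = Inr {a, c}" using 3 su(2) by auto
      moreover have "b \<in> inc_edges G v" "c \<in> inc_edges G v" "a \<noteq> b" "a \<noteq> c" using bc by auto
      ultimately show ?thesis using su(4) af(1) by blast
    qed
  qed
  then obtain a b where ab: "a \<in> inc_edges G v" "b \<in> inc_edges G v" "a \<noteq> b"
    and f: "unc (Inr {a, b})" by blast
  obtain e where e: "inc_edges G v = {a, b, e}" "e \<noteq> a" "e \<noteq> b"
    using third_edge[OF G(1,2) v ab] .

  \<comment> \<open>The double edges at the ends of the uncovered triangle edge\<close>
  have tab: "Inr a \<in># ends H (Inr {a, b})" "Inr b \<in># ends H (Inr {a, b})"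
    by (simp_all add: H_def mem_ends_inflate)
  obtain i where i: "i < 3" "Inr a \<in># ends H (d i)" using unc_end[OF f tab(1)] .
  obtain j where j: "j < 3" "Inr b \<in># ends H (d j)" using unc_end[OF f tab(2)] .
  \<comment> \<open>If the labels agreed, the double edge would join \<open>Inr a\<close> to
    \<open>Inr b\<close>, parallel to the uncovered edge.\<close>
  have ij: "i \<noteq> j" using unc_not_parallel[OF f i(1) tab] ab(3) i j by auto
  obtain k where k: "k < 3" "k \<noteq> i" "k \<noteq> j" using third_index[OF i(1) j(1)] .
  have all3: "l = i \<or> l = j \<or> l = k" if "l < 3" for l using i j k ij that by linarith

  have side: "(d i = Inl a \<and> Inr {a, e} \<in> M i) \<or> (d i = Inr {a, e} \<and> Inl a \<in> M i)"
    if I: "inc_edges G v = {a, b, e}" "distinct [a, b, e]" "unc (Inr {a, b})" "i < 3" "Inr a \<in># ends H (d i)"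
    for a b i
  proof -
    obtain s u where su: "inc_edges H (Inr a) = {d i, s, u}" "distinct [d i, s, u]" "s \<in> M i" "unc u"
      using double_end[OF I(4,5)] by metis
    have "Inr a \<in># ends H (Inr {a, b})" by (simp add: H_def mem_ends_inflate)
    moreover have "Inr a \<in># ends H u" using su(1) inc_iff by blast
    ultimately have "u = Inr {a, b}" using unc_unique[OF su(4) I(3)] by blast
    moreover have "Inr {a, b} \<noteq> (Inr {a, e} :: 'e + 'e set)" using I(2) by auto
    moreover have "{d i, s, u} = {Inl a, Inr {a, b}, Inr {a, e}}" using su(1) incr[OF I(1,2)] by simp
    ultimately have "d i \<in> {Inl a, Inr {a, e}}" "s \<in> {Inl a, Inr {a, e}}" using su(2) by auto
    then show ?thesis using su(2,3) by auto
  qed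
  \<comment> \<open>The double edge leaves the triangle. Otherwise it is \<open>Inr {a, e}\<close>;
    then \<open>Inr {b, e}\<close> is not double, since two double edges have no common end, so it
    lies in \<open>M j\<close>. But \<open>M j\<close> also contains \<open>d i\<close>, and the two
    edges meet at \<open>Inr e\<close>.\<close>
  have out: "d i = Inl a \<and> Inr {a, e} \<in> M i"
    if I: "inc_edges G v = {a, b, e}" "distinct [a, b, e]" "unc (Inr {a, b})"
      and i: "i < 3" "Inr a \<in># ends H (d i)" and j: "j < 3" "Inr b \<in># ends H (d j)" and ij: "i \<noteq> j"
    for a b i j
  proof (rule ccontr)
    assume "\<not> ?thesis"
    then have di: "d i = Inr {a, e}" using side[OF I i] by blast
    have I': "inc_edges G v = {b, a, e}" "distinct [b, a, e]" "unc (Inr {b, a})"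
      using I insert_commute[of a b "{}"] by auto
    have te: "Inr e \<in># ends H (Inr {a, e})" "Inr e \<in># ends H (Inr {b, e})"
      by (simp_all add: H_def mem_ends_inflate)
    have "d j \<noteq> Inr {b, e}" using double_unique[OF i(1) j(1)] ij di te by metis
    then have "Inr {b, e} \<in> M j" using side[OF I' j] by blast
    moreover have "Inr {a, e} \<in> M j" using di d_mem[OF i(1) j(1)] ij by simp
    ultimately have "Inr {a, e} = (Inr {b, e} :: 'e + 'e set)" using uniq[OF j(1) _ _ te] by blast
    then show False using I(2) by auto
  qed
  have dist: "distinct [a, b, e]" using ab e by auto
  have e': "inc_edges G v = {b, a, e}" "distinct [b, a, e]" "unc (Inr {b, a})"
    using e dist f insert_commute[of a b "{}"] by auto
  have di: "d i = Inl a" "Inr {a, e} \<in> M i" using out[OF e(1) dist f i j ij] by auto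
  have dj: "d j = Inl b" "Inr {b, e} \<in> M j" using out[OF e' j i] ij by auto

  \<comment> \<open>The part of the hexagon outside the triangle\<close>
  obtain p where p: "ends G a = {#v, p#}" "v \<noteq> p"
    using ends_eq_pair[OF wfG G(2), of a v] ab(1) unfolding inc_edges_def by blast
  obtain q where q: "ends G b = {#v, q#}" "v \<noteq> q"
    using ends_eq_pair[OF wfG G(2), of b v] ab(2) unfolding inc_edges_def by blast
  have endi: "x \<in># ends H (d i) \<longleftrightarrow> x = Inr a \<or> x = Inl p" for x
    unfolding di H_def ends_inflate_Inl p using p(2) by auto
  have endj: "x \<in># ends H (d j) \<longleftrightarrow> x = Inr b \<or> x = Inl q" for x
    unfolding dj H_def ends_inflate_Inl q using q(2) by auto
  have endf: "x \<in># ends H (Inr {a, b}) \<longleftrightarrow> x = Inr a \<or> x = Inr b" for x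
    unfolding H_def ends_inflate_Inr by auto
  \<comment> \<open>The vertices \<open>Inr a\<close> and \<open>Inr b\<close> already have their
    double edges \<open>d i\<close> and \<open>d j\<close>. At \<open>Inr e\<close> the edge
    \<open>d k\<close>, which lies in \<open>M i\<close>, would have to be \<open>Inr {a, e}\<close>
    and thus reach \<open>Inr a\<close>.\<close>
  have notT: "Inr t \<notin># ends H (d k)" if "t \<in> {a, b, e}" for t
  proof
    assume t: "Inr t \<in># ends H (d k)"
    have "t \<noteq> a" "t \<noteq> b" using t double_unique[OF k(1) i(1)] double_unique[OF k(1) j(1)] k i j by blast+
    then have "t = e" using that by blast
    moreover have "Inr e \<in># ends H (Inr {a, e})" by (simp add: H_def mem_ends_inflate)
    moreover have "d k \<in> M i" using d_mem[OF k(1) i(1)] k(2) by simp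
    ultimately have "d k = Inr {a, e}" using uniq[OF i(1) _ di(2)] t by blast
    then have "Inr a \<in># ends H (d k)" by (simp add: H_def mem_ends_inflate)
    then show False using double_unique[OF k(1) i(1)] k i by blast
  qed
  obtain g where g: "d k = Inl g"
  proof (cases "d k")
    case (Inr s)
    then obtain e1 e2 where "s = {e1, e2}" "e1 \<in> inc_edges G v"
      using d_edge[OF k(1)] by (auto simp: H_def Inr_in_edges_inflate)
    then have "Inr e1 \<in># ends H (d k)" "e1 \<in> {a, b, e}"
      using Inr e(1) by (auto simp: H_def mem_ends_inflate)
    then show thesis using notT by blast
  qed (use that in blast)
  have gE: "g \<in> edges G" using d_edge[OF k(1)] g by (simp add: H_def Inl_in_edges_inflate)
  have gv: "v \<notin># ends G g"
  proof
    assume "v \<in># ends G g"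
    then have "g \<in> {a, b, e}" "Inr g \<in># ends H (d k)"
      using gE e(1) g unfolding inc_edges_def by (auto simp: H_def mem_ends_inflate)
    then show False using notT by blast
  qed

  \<comment> \<open>From the outer end of \<open>d i\<close> the hexagon continues by an uncovered
    edge to an end of \<open>d k\<close>. The variables are generalised so that the same argument
    runs from the side of \<open>d j\<close>.\<close>
  have path: "\<exists>u w. unc u \<and> ends H u = {#Inl p, w#} \<and> w \<in># ends H (d k)"
    if f: "unc (Inr {a, b})" "\<And>x. x \<in># ends H (Inr {a, b}) \<longleftrightarrow> x = Inr a \<or> x = Inr b"
      and i: "i < 3" "\<And>x. x \<in># ends H (d i) \<longleftrightarrow> x = Inr a \<or> x = Inl p"
      and j: "j < 3" "\<And>x. x \<in># ends H (d j) \<longleftrightarrow> x = Inr b \<or> x = Inl q"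
      and all3: "\<And>l. l < 3 \<Longrightarrow> l = i \<or> l = j \<or> l = k" and k: "k < 3" "k \<noteq> i" "k \<noteq> j"
    for a b i j p q
  proof -
    have pi: "Inl p \<in># ends H (d i)" using i by simp
    obtain u where u: "unc u" "Inl p \<in># ends H u"
      using double_end[OF i(1) pi] inc_iff by (metis insertCI)
    obtain w where w: "ends H u = {#Inl p, w#}" "Inl p \<noteq> w"
      using ends_eq_pair[OF wf ll _ u(2)] u(1) by blast
    have wu: "w \<in># ends H u" using w by simp
    obtain l where l: "l < 3" "w \<in># ends H (d l)" using unc_end[OF u(1) wu] .
    have "l \<noteq> i" using unc_not_parallel[OF u(1) i(1) u(2) wu w(2) pi] l by blast
    \<comment> \<open>Otherwise the core closes up as a quadrilateral through \<open>d i\<close> and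
      \<open>d j\<close>. The uncovered edge at an end \<open>y\<close> of \<open>d k\<close> is not
      parallel to \<open>d k\<close>, so it ends in that quadrilateral. By \<open>unc_unique\<close>
      it is one of its two uncovered edges, which places \<open>y\<close> on the quadrilateral as
      well.\<close>
    moreover have "l \<noteq> j"
    proof
      assume "l = j"
      have "w \<noteq> Inr b"
      proof
        assume "w = Inr b"
        then have "u = Inr {a, b}" using unc_unique[OF u(1) f(1) wu] f(2) by blast
        then show False using u(2) f(2) by blast
      qed
      then have wq: "w = Inl q" using l \<open>l = j\<close> j by blast
      obtain y where y: "y \<in># ends H (d k)" "y \<in> verts H"
        using ends_pair_cases[OF wf ll d_edge[OF k(1)]] by (metis union_single_eq_member)
      obtain u3 where u3: "unc u3" "y \<in># ends H u3"
        using double_end[OF k(1) y(1)] inc_iff by (metis insertCI)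
      obtain w3 where w3: "ends H u3 = {#y, w3#}" "y \<noteq> w3"
        using ends_eq_pair[OF wf ll _ u3(2)] u3(1) by blast
      have w3u: "w3 \<in># ends H u3" using w3 by simp
      obtain m where m: "m < 3" "w3 \<in># ends H (d m)" using unc_end[OF u3(1) w3u] .
      have "m \<noteq> k" using unc_not_parallel[OF u3(1) k(1) u3(2) w3u w3(2) y(1)] m by blast
      then have "m = i \<or> m = j" using all3 m by blast
      then have "w3 \<in> {Inr a, Inr b, Inl p, Inl q}" using m i j by blast
      then have "u3 = Inr {a, b} \<or> u3 = u"
        using unc_unique[OF u3(1) f(1) w3u] unc_unique[OF u3(1) u(1) w3u] f(2) u(2) wu wq by blast
      moreover have "set_mset (ends H u) = {Inl p, Inl q}" using w wq by simp
      ultimately have "y \<in> {Inr a, Inr b, Inl p, Inl q}" using u3(2) f(2) by blast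
      then show False
        using double_unique[OF k(1) i(1) y(1)] double_unique[OF k(1) j(1) y(1)] k i j by blast
    qed
    ultimately have "l = k" using all3 l by blast
    then show ?thesis using u w l by blast
  qed
  obtain u1 w1 where u1: "unc u1" "ends H u1 = {#Inl p, w1#}" "w1 \<in># ends H (d k)"
    using path[OF f endf i(1) endi j(1) endj all3 k] by blast
  have "unc (Inr {b, a})" "\<And>x. x \<in># ends H (Inr {b, a}) \<longleftrightarrow> x = Inr b \<or> x = Inr a"
      "\<And>l. l < 3 \<Longrightarrow> l = j \<or> l = i \<or> l = k"
    using f endf all3 insert_commute[of a b "{}"] by auto
  then obtain u2 w2 where u2: "unc u2" "ends H u2 = {#Inl q, w2#}" "w2 \<in># ends H (d k)"
    using path[OF _ _ j(1) endj i(1) endi _ k(1,3,2)] by blast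
  have gInl: "\<exists>y. w = Inl y \<and> y \<noteq> v \<and> y \<in># ends G g" if "w \<in># ends H (d k)" for w
    using that gv unfolding g by (cases w) (auto simp: H_def mem_ends_inflate)
  obtain y where y: "w1 = Inl y" "y \<noteq> v" "y \<in># ends G g" using gInl u1(3) by blast
  obtain z where z: "w2 = Inl z" "z \<noteq> v" "z \<in># ends G g" using gInl u2(3) by blast
  have pq: "p \<noteq> q" using double_unique[OF i(1) j(1), of "Inl p"] endi endj ij by blast
  have pk: "Inl p \<notin># ends H (d k)" and qk: "Inl q \<notin># ends H (d k)"
    using double_unique[OF i(1) k(1)] double_unique[OF j(1) k(1)] endi endj k by blast+
  have ne: "p \<noteq> y" "p \<noteq> z" "q \<noteq> y" "q \<noteq> z" using pk qk u1 u2 y z by auto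
  \<comment> \<open>If the ends agreed, \<open>u1\<close> and \<open>u2\<close> would be one edge
    with the three distinct ends \<open>p\<close>, \<open>q\<close> and \<open>y\<close>.\<close>
  have yz: "y \<noteq> z"
  proof
    assume "y = z"
    then have "u1 = u2" using unc_unique[OF u1(1) u2(1), of "Inl y"] u1 u2 y z by simp
    then have "Inl q \<in># ends H u1" using u2 by simp
    then show False using u1(2) y pq ne by auto
  qed
  have lift: "\<exists>h. u = Inl h \<and> h \<in> edges G \<and> ends G h = {#r, y#}"
    if "unc u" "ends H u = {#Inl r, Inl y#}" "r \<noteq> y" for u r y
  proof -
    have m: "Inl r \<in># ends H u" "Inl y \<in># ends H u" using that by auto
    obtain h where h: "u = Inl h"
      using m(1) by (cases u) (auto simp: H_def mem_ends_inflate)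
    then have hE: "h \<in> edges G" using that(1) by (simp add: H_def Inl_in_edges_inflate)
    moreover have "r \<in># ends G h" "y \<in># ends G h" using m unfolding h by (auto simp: H_def mem_ends_inflate)
    ultimately show ?thesis using h ends_eq_pair_of_mem[OF wfG G(2) hE _ _ that(3)] by blast
  qed
  obtain h1 where h1: "u1 = Inl h1" "h1 \<in> edges G" "ends G h1 = {#p, y#}"
    using lift[OF u1(1)] u1(2) y ne by blast
  obtain h2 where h2: "u2 = Inl h2" "h2 \<in> edges G" "ends G h2 = {#q, z#}"
    using lift[OF u2(1)] u2(2) z ne by blast
  have endg: "ends G g = {#y, z#}" using ends_eq_pair_of_mem[OF wfG G(2) gE y(3) z(3) yz] .
  have abE: "a \<in> edges G" "b \<in> edges G" using ab unfolding inc_edges_def by auto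
  \<comment> \<open>Contracting the triangle identifies \<open>Inr a\<close> and
    \<open>Inr b\<close> with \<open>v\<close> and removes \<open>Inr {a, b}\<close>; the other five
    edges of the hexagon form the pentagon.\<close>
  let ?xs = "[v, p, y, z, q]" and ?es = "[a, h1, g, h2, b]"
  have pent: "pentagon G ?xs ?es"
  proof -
    have "distinct (map (\<lambda>e. set_mset (ends G e)) ?es)"
      using p q y(2) z(2) pq ne yz h1(3) h2(3) endg by (auto simp: doubleton_eq_iff)
    then have "distinct ?es" by (rule distinct_map[THEN iffD1, THEN conjunct1])
    moreover have "distinct ?xs" using p q y(2) z(2) pq ne yz by auto
    moreover have "set_mset (ends G h1) \<subseteq> verts G" "set_mset (ends G h2) \<subseteq> verts G"
      using wfG h1(2) h2(2) unfolding wf_graph_def by blast+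
    then have "set ?xs \<subseteq> verts G" using v unfolding h1(3) h2(3) by simp
    moreover have "?es ! i \<in> edges G \<and> ends G (?es ! i) = {# ?xs ! i, ?xs ! ((i + 1) mod 5) #}"
      if "i < 5" for i
    proof -
      have "i = 0 \<or> i = 1 \<or> i = 2 \<or> i = 3 \<or> i = 4" using that by linarith
      then show ?thesis using abE h1 h2 gE p q endg by (auto simp: add_mset_commute)
    qed
    ultimately show ?thesis unfolding pentagon_def by simp
  qed

  \<comment> \<open>Every uncovered edge has an end on some double edge, hence is one of the three
    uncovered edges of the hexagon by \<open>unc_unique\<close>. One of these is a triangle edge,
    and the other two end in \<open>y\<close> or \<open>z\<close>.\<close>
  have cov: "\<exists>m<3. Inl h \<in> M m" if h: "h \<in> edges G" "y \<notin># ends G h" "z \<notin># ends G h" for h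
  proof (rule ccontr)
    assume "\<not> ?thesis"
    then have u: "unc (Inl h)" using h(1) by (auto simp: H_def Inl_in_edges_inflate)
    obtain x where x: "x \<in># ends H (Inl h)"
      using ends_pair_cases[OF wf ll, of "Inl h"] u by (metis union_single_eq_member)
    obtain l where l: "l < 3" "x \<in># ends H (d l)" using unc_end[OF u x] .
    have "x \<in># ends H (d k) \<Longrightarrow> x \<in> {Inl y, Inl z}"
      using gInl[of x] endg by auto
    then have "x \<in> {Inr a, Inr b, Inl p, Inl q, Inl y, Inl z}"
      using l all3[OF l(1)] endi endj by blast
    then have "Inl h \<in> {Inr {a, b}, u1, u2}"
      using unc_unique[OF u f x] unc_unique[OF u u1(1) x] unc_unique[OF u u2(1) x] endf u1(2) u2(2) y z
      by auto
    then show False using h h1 h2 by auto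
  qed
  \<comment> \<open>Each edge receives the index of a matching containing it. The double edges
    \<open>a\<close> and \<open>b\<close> allow two choices: since \<open>Inr {a, e}\<close> is in
    \<open>M i\<close> and \<open>Inr {b, e}\<close> in \<open>M j\<close>, the edge
    \<open>e\<close> is left with colour \<open>k\<close>, so \<open>a\<close> takes
    \<open>j\<close> and \<open>b\<close> takes \<open>i\<close>.\<close>
  define c where "c h = (if h = a then j else if h = b then i else SOME m. m < 3 \<and> Inl h \<in> M m)" for h
  have cM: "c h < 3 \<and> Inl h \<in> M (c h)" if h: "h \<in> edges G" "y \<notin># ends G h" "z \<notin># ends G h" for h
  proof -
    have "Inl a \<in> M j" "Inl b \<in> M i"
      using di(1) dj(1) d_mem[OF i(1) j(1)] d_mem[OF j(1) i(1)] ij by auto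
    moreover have "(SOME m. m < 3 \<and> Inl h \<in> M m) < 3 \<and> Inl h \<in> M (SOME m. m < 3 \<and> Inl h \<in> M m)"
      by (rule someI_ex[OF cov[OF h]])
    ultimately show ?thesis using i j unfolding c_def by auto
  qed
  let ?G' = "del_verts G {y, z}"
  have inc': "inc_edges ?G' x \<subseteq> {h \<in> inc_edges G x. y \<notin># ends G h \<and> z \<notin># ends G h}" for x
    unfolding inc_edges_def del_verts_def by auto
  have "inj_on c (inc_edges ?G' x)" if x: "x \<in> verts ?G'" for x
  proof (rule inj_onI)
    fix h h' assume hh: "h \<in> inc_edges ?G' x" "h' \<in> inc_edges ?G' x" "c h = c h'"
    have hE: "h \<in> edges G" "y \<notin># ends G h" "z \<notin># ends G h" "x \<in># ends G h"
      and hE': "h' \<in> edges G" "y \<notin># ends G h'" "z \<notin># ends G h'" "x \<in># ends G h'"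
      using hh inc'[of x] unfolding inc_edges_def[of G] by auto
    have c: "c h < 3" "Inl h \<in> M (c h)" "Inl h' \<in> M (c h)" using cM hE hE' hh(3) by metis+
    show "h = h'"
    proof (cases "x = v")
      case False
      then have "Inl x \<in># ends H (Inl h)" "Inl x \<in># ends H (Inl h')"
        using hE hE' by (simp_all add: H_def mem_ends_inflate)
      then show ?thesis using uniq[OF c] by blast
    next
      case True
      have "h \<in> {a, b, e}" "h' \<in> {a, b, e}" using hE hE' True e(1) unfolding inc_edges_def by auto
      moreover have "c a = j" "c b = i" using ab(3) unfolding c_def by auto
      moreover have "c e \<noteq> i \<and> c e \<noteq> j" if "e \<in> {h, h'}"
      proof -
        have m: "Inl e \<in> M (c e)" using cM that hE hE' by blast
        have "Inr e \<in># ends H (Inl e)" using that hE hE' True by (auto simp: H_def mem_ends_inflate)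
        moreover have "Inr e \<in># ends H (Inr {a, e})" "Inr e \<in># ends H (Inr {b, e})"
          by (simp_all add: H_def mem_ends_inflate)
        ultimately show ?thesis using uniq[OF i(1) _ di(2)] uniq[OF j(1) _ dj(2)] m by blast
      qed
      ultimately show ?thesis using hh(3) ij by auto
    qed
  qed
  moreover have "c h < 3" if "h \<in> edges ?G'" for h using that cM by (auto simp: del_verts_def)
  ultimately have "proper_3_edge_colouring ?G' c"
    unfolding proper_3_edge_colouring_iff[OF wf_graph_del_verts[OF wfG] loopless_del_verts[OF G(2)]]
    by blast
  \<comment> \<open>The heavy edge is \<open>g\<close>, at position 2 of the list, with ends
    \<open>y\<close> and \<open>z\<close>.\<close>
  then have "heavy_pentagon G ?xs ?es"
    using pent unfolding heavy_pentagon_def colourable3_def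
    by (intro conjI exI[of _ 2]) auto
  then show ?thesis unfolding on_heavy_pentagon_def by (intro exI[of _ ?xs] exI[of _ ?es]) auto
qed

section \<open>Colourings outside a pentagon\<close>

lemma extend_colouring:
  assumes "finite A" "card A = 3" "B \<subseteq> A" "inj_on c B" "c ` B \<subseteq> {..<3::nat}"
  obtains f where "inj_on f A" "f ` A \<subseteq> {..<3}" "\<And>e. e \<in> B \<Longrightarrow> f e = c e"
proof -
  have finB: "finite B" using assms finite_subset by blast
  have "card (A - B) = card ({..<3} - c ` B)"
    using assms finB by (simp add: card_Diff_subset card_image)
  then obtain h where h: "bij_betw h (A - B) ({..<3} - c ` B)"
    using finite_same_card_bij assms(1) by blast
  define f where "f e = (if e \<in> B then c e else h e)" for e
  have "bij_betw f B (c ` B)"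
    using assms(4) by (auto simp: bij_betw_def f_def inj_on_def)
  moreover have "bij_betw f (A - B) ({..<3} - c ` B)"
    using h by (rule bij_betw_cong[THEN iffD1, rotated]) (simp add: f_def)
  ultimately have "bij_betw f (B \<union> (A - B)) (c ` B \<union> ({..<3} - c ` B))"
    by (rule bij_betw_combine) blast
  moreover have "B \<union> (A - B) = A" "c ` B \<union> ({..<3} - c ` B) = {..<3}" using assms by auto
  ultimately have "bij_betw f A {..<3}" by simp
  then show thesis using that[of f] by (auto simp: bij_betw_def f_def)
qed

text \<open>For a pentagon \<open>P\<close> this describes a colouring of the rest of the graph
  including the edges that leave \<open>P\<close>. It assigns values to all edges, so that only the
  values on the pentagon edges have to be replaced to colour \<open>G\<close>.\<close>

definition outer_colouring :: "('v, 'e) mgraph \<Rightarrow> 'v set \<Rightarrow> ('e \<Rightarrow> nat) \<Rightarrow> bool" where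
  "outer_colouring G P c \<longleftrightarrow>
    (\<forall>e \<in> edges G. c e < 3) \<and> (\<forall>x \<in> verts G - P. inj_on c (inc_edges G x))"

text \<open>At every vertex outside \<open>S\<close> the colouring is completed separately. The
  completions are compatible because an edge between \<open>S\<close> and its complement has just
  one end outside \<open>S\<close>.\<close>

lemma outer_colouring_of_deleted:
  assumes G: "cubic G" "loopless G" and "S \<subseteq> P" and col: "colourable3 (del_verts G S)"
  obtains c where "outer_colouring G P c"
proof -
  have wf: "wf_graph G" using G(1) unfolding cubic_def by simp
  obtain c0 where c0: "\<And>e. e \<in> edges (del_verts G S) \<Longrightarrow> c0 e < (3::nat)"
    "\<And>x. x \<in> verts (del_verts G S) \<Longrightarrow> inj_on c0 (inc_edges (del_verts G S) x)"
    using col unfolding colourable3_def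
      proper_3_edge_colouring_iff[OF wf_graph_del_verts[OF wf] loopless_del_verts[OF G(2)]] by blast
  have "\<exists>f. inj_on f (inc_edges G x) \<and> f ` inc_edges G x \<subseteq> {..<3} \<and>
      (\<forall>e \<in> inc_edges (del_verts G S) x. f e = c0 e)" if x: "x \<in> verts G" "x \<notin> S" for x
  proof -
    have sub: "inc_edges (del_verts G S) x \<subseteq> inc_edges G x" by (auto simp: inc_edges_def del_verts_def)
    have inj: "inj_on c0 (inc_edges (del_verts G S) x)"
      using c0(2) x by (simp add: del_verts_def)
    have "c0 ` inc_edges (del_verts G S) x \<subseteq> {..<3}"
      using c0(1) by (auto simp: inc_edges_def)
    from extend_colouring[OF finite_inc_edges[OF wf] card_inc_edges[OF G x(1)] sub inj this]
    obtain f where "inj_on f (inc_edges G x)" "f ` inc_edges G x \<subseteq> {..<3}"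
      "\<And>e. e \<in> inc_edges (del_verts G S) x \<Longrightarrow> f e = c0 e" by blast
    then show ?thesis by blast
  qed
  then have "\<exists>f. \<forall>x. x \<in> verts G \<and> x \<notin> S \<longrightarrow> inj_on (f x) (inc_edges G x) \<and>
      f x ` inc_edges G x \<subseteq> {..<3} \<and> (\<forall>e \<in> inc_edges (del_verts G S) x. f x e = c0 e)"
    by (intro choice) blast
  then obtain f where f: "\<And>x. x \<in> verts G \<Longrightarrow> x \<notin> S \<Longrightarrow> inj_on (f x) (inc_edges G x)"
    "\<And>x e. x \<in> verts G \<Longrightarrow> x \<notin> S \<Longrightarrow> e \<in> inc_edges G x \<Longrightarrow> f x e < 3"
    "\<And>x e. x \<in> verts G \<Longrightarrow> x \<notin> S \<Longrightarrow> e \<in> inc_edges (del_verts G S) x \<Longrightarrow> f x e = c0 e"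
    unfolding image_subset_iff lessThan_iff by blast
  \<comment> \<open>The chosen end decides the colour; \<open>c_eq\<close> shows independence of the
    choice. Edges inside \<open>S\<close> get the default colour 0.\<close>
  define c where "c e = (if \<exists>x. x \<in># ends G e \<and> x \<notin> S
      then f (SOME x. x \<in># ends G e \<and> x \<notin> S) e else 0)" for e
  have c_eq: "c e = f x e" if x: "x \<in> verts G" "x \<notin> S" "e \<in> inc_edges G x" for x e
  proof -
    let ?y = "SOME x. x \<in># ends G e \<and> x \<notin> S"
    have ex: "\<exists>x. x \<in># ends G e \<and> x \<notin> S" using x by (auto simp: inc_edges_def)
    have y: "?y \<in># ends G e \<and> ?y \<notin> S" using ex by (rule someI_ex)
    have eE: "e \<in> edges G" "x \<in># ends G e" using x by (auto simp: inc_edges_def)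
    have yV: "?y \<in> verts G" using y eE wf unfolding wf_graph_def by blast
    have "f ?y e = f x e"
    proof (cases "e \<in> edges (del_verts G S)")
      case True
      then have "e \<in> inc_edges (del_verts G S) x" "e \<in> inc_edges (del_verts G S) ?y"
        using y eE by (simp_all add: inc_edges_def del_verts_def)
      then show ?thesis using f(3) x y yV by metis
    next
      case False
      then obtain s where s: "s \<in># ends G e" "s \<in> S" using eE by (auto simp: del_verts_def)
      obtain z where "ends G e = {#x, z#}" using ends_eq_pair[OF wf G(2) eE] .
      then have "?y = x" using s y x(2) by auto
      then show ?thesis by simp
    qed
    then show ?thesis using ex unfolding c_def by simp
  qed
  have "inj_on c (inc_edges G x)" if "x \<in> verts G - P" for x
  proof -
    have x: "x \<in> verts G" "x \<notin> S" using that assms(3) by auto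
    have "inj_on c (inc_edges G x) = inj_on (f x) (inc_edges G x)"
      by (rule inj_on_cong) (rule c_eq[OF x])
    then show ?thesis using f(1)[OF x] by simp
  qed
  moreover have "c e < 3" if e: "e \<in> edges G" for e
  proof (cases "\<exists>x. x \<in># ends G e \<and> x \<notin> S")
    case True
    then obtain x where x: "x \<in># ends G e" "x \<notin> S" by blast
    then have xV: "x \<in> verts G" "e \<in> inc_edges G x" using wf e unfolding wf_graph_def inc_edges_def by auto
    show ?thesis using c_eq[OF xV(1) x(2) xV(2)] f(2)[OF xV(1) x(2) xV(2)] by simp
  next
    case False
    then show ?thesis unfolding c_def by auto
  qed
  ultimately show thesis using that unfolding outer_colouring_def by blast
qed

lemma outer_colour_class:
  assumes "cubic G" "loopless G" "outer_colouring G P c" "x \<in> verts G" "x \<notin> P" "i < 3"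
  obtains e where "{f \<in> inc_edges G x. c f = i} = {e}"
proof -
  have inj: "inj_on c (inc_edges G x)" and sub: "c ` inc_edges G x \<subseteq> {..<3}"
    using assms unfolding outer_colouring_def inc_edges_def by auto
  have "card (c ` inc_edges G x) = card {..<3::nat}"
    using card_inc_edges[OF assms(1,2,4)] inj by (simp add: card_image)
  then have "c ` inc_edges G x = {..<3}" using card_subset_eq[OF _ sub] by simp
  then obtain e where "e \<in> inc_edges G x" "c e = i" using assms(6) by (metis imageE lessThan_iff)
  then have "{f \<in> inc_edges G x. c f = i} = {e}" using inj unfolding inj_on_def by blast
  then show thesis using that by blast
qed

section \<open>Kempe chains as vertex sets with small boundary\<close>

definition boundary :: "('v, 'e) mgraph \<Rightarrow> 'e set \<Rightarrow> 'v set \<Rightarrow> 'e set" where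
  "boundary G A K = {e \<in> A. (\<exists>x \<in># ends G e. x \<in> K) \<and> (\<exists>x \<in># ends G e. x \<notin> K)}"

text \<open>A Kempe chain without paths: among the vertex sets with at most two boundary edges a maximal one
  cannot be enlarged along a boundary edge, because a new vertex has only one further edge in \<open>A\<close>.\<close>

lemma kempe_set_exists:
  assumes wf: "wf_graph G" and ll: "loopless G" and A: "A \<subseteq> edges G" and W: "W \<subseteq> verts G" and w: "w \<in> W"
    and two: "\<And>x. x \<in> W \<Longrightarrow> card {e \<in> A. x \<in># ends G e} = 2"
  obtains K where "w \<in> K" "K \<subseteq> W" "card (boundary G A K) \<le> 2"
    "\<And>e. e \<in> boundary G A K \<Longrightarrow> \<exists>x \<in># ends G e. x \<notin> W"
proof -
  have fin: "finite W" "finite A"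
    using wf W A unfolding wf_graph_def by (auto intro: finite_subset)
  have finb: "finite (boundary G A K)" for K using fin unfolding boundary_def by simp
  define F where "F = {K. K \<subseteq> W \<and> w \<in> K \<and> card (boundary G A K) \<le> 2}"
  have "card (boundary G A {w}) \<le> card {e \<in> A. w \<in># ends G e}"
    using fin by (intro card_mono) (auto simp: boundary_def)
  then have "{w} \<in> F" using w two[OF w] unfolding F_def by simp
  moreover have "finite F" by (rule finite_subset[of _ "Pow W"]) (use fin in \<open>auto simp: F_def\<close>)
  ultimately have "\<exists>K\<in>F. \<forall>L\<in>F. K \<subseteq> L \<longrightarrow> K = L"
    by (intro finite_has_maximal) blast+
  then obtain K where K: "K \<in> F" and max: "\<And>L. L \<in> F \<Longrightarrow> K \<subseteq> L \<Longrightarrow> L = K" by blast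
  have "\<exists>x \<in># ends G e. x \<notin> W" if e: "e \<in> boundary G A K" for e
  proof (rule ccontr)
    assume inW: "\<not> (\<exists>x \<in># ends G e. x \<notin> W)"
    have eA: "e \<in> A" using e unfolding boundary_def by simp
    obtain a b where ab: "a \<in># ends G e" "a \<in> K" "b \<in># ends G e" "b \<notin> K"
      using e unfolding boundary_def by blast
    then have bW: "b \<in> W" using inW by blast
    have "ends G e = {#a, b#}"
      using ends_eq_pair_of_mem[OF wf ll _ ab(1,3)] ab eA A by blast
    then have "boundary G A (insert b K) \<subseteq> (boundary G A K - {e}) \<union> ({f \<in> A. b \<in># ends G f} - {e})"
      using ab unfolding boundary_def by auto
    then have "card (boundary G A (insert b K)) \<le> card ((boundary G A K - {e}) \<union> ({f \<in> A. b \<in># ends G f} - {e}))"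
      using finb fin by (intro card_mono) auto
    also have "\<dots> \<le> card (boundary G A K - {e}) + card ({f \<in> A. b \<in># ends G f} - {e})"
      by (rule card_Un_le)
    also have "\<dots> \<le> 2"
      using K e two[OF bW] ab eA finb fin unfolding F_def by auto
    finally have "insert b K \<in> F" using K bW unfolding F_def by auto
    then show False using max[of "insert b K"] ab by blast
  qed
  then show thesis using that K unfolding F_def by blast
qed

text \<open>The arguments are the colours of the edges leaving a pentagon, in cyclic order. The
  three equal ones are the first and its two cyclic neighbours.\<close>

definition consecutive :: "nat \<Rightarrow> nat \<Rightarrow> nat \<Rightarrow> nat \<Rightarrow> nat \<Rightarrow> bool" where
  "consecutive a b c d e \<longleftrightarrow> e = a \<and> a = b \<and> a \<noteq> c \<and> a \<noteq> d \<and> c \<noteq> d"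

text \<open>The first argument belongs to the centre: its two cyclic neighbours carry the
  exceptional colours.\<close>

definition centred :: "nat \<Rightarrow> nat \<Rightarrow> nat \<Rightarrow> nat \<Rightarrow> nat \<Rightarrow> bool" where
  "centred a b c d e \<longleftrightarrow> a = c \<and> a = d \<and> a \<noteq> b \<and> a \<noteq> e \<and> b \<noteq> e"

definition occ :: "nat \<Rightarrow> nat \<Rightarrow> nat \<Rightarrow> nat \<Rightarrow> nat \<Rightarrow> nat \<Rightarrow> nat" where
  "occ i a b c d e = of_bool (a = i) + of_bool (b = i) + of_bool (c = i) + of_bool (d = i) + of_bool (e = i)"

text \<open>The three multiplicities have equal parity and sum to five, so they are 3, 1, 1. The two
  exceptional positions are cyclically adjacent or at distance two, which gives five placements of
  either kind.\<close>

lemma five_colours_cases: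
  assumes "a < 3" "b < 3" "c < 3" "d < 3" "e < 3"
    and "even (occ 0 a b c d e) = even (occ 1 a b c d e)" "even (occ 1 a b c d e) = even (occ 2 a b c d e)"
  shows "consecutive a b c d e \<or> consecutive b c d e a \<or> consecutive c d e a b \<or>
    consecutive d e a b c \<or> consecutive e a b c d \<or>
    centred a b c d e \<or> centred b c d e a \<or> centred c d e a b \<or> centred d e a b c \<or> centred e a b c d"
proof -
  have v: "n = 0 \<or> n = 1 \<or> n = 2" if "n < 3" for n :: nat using that by linarith
  show ?thesis
    using v[OF assms(1)] v[OF assms(2)] v[OF assms(3)] v[OF assms(4)] v[OF assms(5)] assms(6,7)
    unfolding occ_def consecutive_def centred_def
    by (elim disjE) simp_all
qed

text \<open>The edge \<open>g0\<close> joins \<open>x0\<close> to \<open>x1\<close> and so on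
  cyclically; \<open>o0\<close> to \<open>o4\<close> are the third edges at the vertices. A chord is
  listed at both of its ends, so these five may coincide in part. The cyclic naming makes
  \<open>rotate\<close> available, and arguments are given at one position only.\<close>

locale cubic_pentagon =
  fixes G :: "('v, 'e) mgraph" and x0 x1 x2 x3 x4 :: 'v and g0 g1 g2 g3 g4 o0 o1 o2 o3 o4 :: 'e
  assumes cubic: "cubic G" and ll: "loopless G"
    and dx: "distinct [x0, x1, x2, x3, x4]" and xV: "{x0, x1, x2, x3, x4} \<subseteq> verts G"
    and eg: "ends G g0 = {#x0, x1#}" "ends G g1 = {#x1, x2#}" "ends G g2 = {#x2, x3#}"
      "ends G g3 = {#x3, x4#}" "ends G g4 = {#x4, x0#}"
    and inc: "inc_edges G x0 = {g4, g0, o0}" "inc_edges G x1 = {g0, g1, o1}" "inc_edges G x2 = {g1, g2, o2}"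
      "inc_edges G x3 = {g2, g3, o3}" "inc_edges G x4 = {g3, g4, o4}"
    and di: "distinct [g4, g0, o0]" "distinct [g0, g1, o1]" "distinct [g1, g2, o2]"
      "distinct [g2, g3, o3]" "distinct [g3, g4, o4]"
begin

abbreviation "P \<equiv> {x0, x1, x2, x3, x4}"

lemma rotate: "cubic_pentagon G x1 x2 x3 x4 x0 g1 g2 g3 g4 g0 o1 o2 o3 o4 o0"
  using cubic ll dx xV eg inc di by unfold_locales auto

lemma wf: "wf_graph G" using cubic unfolding cubic_def by simp

lemma gE: "g0 \<in> edges G" "g1 \<in> edges G" "g2 \<in> edges G" "g3 \<in> edges G" "g4 \<in> edges G"
  using inc unfolding inc_edges_def by blast+

lemma oE: "o0 \<in> edges G" "o1 \<in> edges G" "o2 \<in> edges G" "o3 \<in> edges G" "o4 \<in> edges G"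
  using inc unfolding inc_edges_def by blast+

lemma o_ends: "x0 \<in># ends G o0" "x1 \<in># ends G o1" "x2 \<in># ends G o2" "x3 \<in># ends G o3" "x4 \<in># ends G o4"
  using inc unfolding inc_edges_def by blast+

lemma dg: "distinct [g0, g1, g2, g3, g4]"
proof -
  have "distinct (map (\<lambda>e. set_mset (ends G e)) [g0, g1, g2, g3, g4])"
    using dx eg by (auto simp: doubleton_eq_iff)
  then show ?thesis by (rule distinct_map[THEN iffD1, THEN conjunct1])
qed

lemma o_not_g: "{o0, o1, o2, o3, o4} \<inter> {g0, g1, g2, g3, g4} = {}"
proof -
  have "o0 \<notin> {g1, g2, g3}" "o1 \<notin> {g2, g3, g4}" "o2 \<notin> {g0, g3, g4}" "o3 \<notin> {g0, g1, g4}" "o4 \<notin> {g0, g1, g2}"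
    using o_ends dx by (auto simp: eg)
  then show ?thesis using di by auto
qed

lemma g_ends_in_P: "e \<in> {g0, g1, g2, g3, g4} \<Longrightarrow> x \<in># ends G e \<Longrightarrow> x \<in> P"
  using eg by auto

lemma outer_third_edge:
  assumes "e \<in> edges G" "e \<notin> {g0, g1, g2, g3, g4}"
  shows "x0 \<in># ends G e \<longleftrightarrow> e = o0" "x1 \<in># ends G e \<longleftrightarrow> e = o1" "x2 \<in># ends G e \<longleftrightarrow> e = o2"
    "x3 \<in># ends G e \<longleftrightarrow> e = o3" "x4 \<in># ends G e \<longleftrightarrow> e = o4"
  using inc assms o_ends unfolding inc_edges_def by blast+

text \<open>Apply the handshake identity to the edges of colour \<open>i\<close> off the pentagon.
  Their degree is 1 at every vertex outside \<open>P\<close>, and at a vertex of \<open>P\<close> it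
  is 1 or 0 according to the colour of its third edge. A chord is counted at both ends. Hence all
  three colours have occurrence counts of the same parity.\<close>

lemma outer_parity:
  assumes c: "outer_colouring G P c" and i: "i < 3"
  shows "even (card (verts G - P) + occ i (c o0) (c o1) (c o2) (c o3) (c o4))"
proof -
  define F where "F = {e \<in> edges G. e \<notin> {g0, g1, g2, g3, g4} \<and> c e = i}"
  have fin: "finite (verts G)" using wf unfolding wf_graph_def by simp
  have sub: "F \<subseteq> edges G" unfolding F_def by auto
  have deg: "deg_in G F x = card {e \<in> F. x \<in># ends G e}" for x
    using deg_in_eq_card[OF wf ll sub] .
  have one: "deg_in G F x = 1" if x: "x \<in> verts G - P" for x
  proof -
    obtain e where e: "{f \<in> inc_edges G x. c f = i} = {e}"
      using outer_colour_class[OF cubic ll c _ _ i, of x] x by blast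
    have "{f \<in> F. x \<in># ends G f} = {f \<in> inc_edges G x. c f = i}"
      using g_ends_in_P x unfolding F_def inc_edges_def by blast
    then show ?thesis unfolding deg e by simp
  qed
  have "{e \<in> F. x0 \<in># ends G e} = (if c o0 = i then {o0} else {})"
    "{e \<in> F. x1 \<in># ends G e} = (if c o1 = i then {o1} else {})"
    "{e \<in> F. x2 \<in># ends G e} = (if c o2 = i then {o2} else {})"
    "{e \<in> F. x3 \<in># ends G e} = (if c o3 = i then {o3} else {})"
    "{e \<in> F. x4 \<in># ends G e} = (if c o4 = i then {o4} else {})"
    using outer_third_edge oE o_ends o_not_g unfolding F_def by (auto split: if_splits)
  then have P: "(\<Sum>x\<in>P. deg_in G F x) = occ i (c o0) (c o1) (c o2) (c o3) (c o4)"
    using dx unfolding occ_def by (simp add: deg)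
  have "2 * card F = (\<Sum>x\<in>verts G - P. deg_in G F x) + (\<Sum>x\<in>P. deg_in G F x)"
    using handshake[OF wf sub] sum.subset_diff[OF xV fin, of "deg_in G F"] by simp
  also have "(\<Sum>x\<in>verts G - P. deg_in G F x) = card (verts G - P)" using one by simp
  finally show ?thesis unfolding P by presburger
qed

text \<open>Along the run of outer edges coloured \<open>r\<close> the pentagon edges
  \<open>g3\<close>, \<open>g4\<close>, \<open>g0\<close>, \<open>g1\<close> alternate between
  \<open>p\<close> and \<open>q\<close>; the opposite edge \<open>g2\<close> takes
  \<open>r\<close>.\<close>

lemma consecutive_colourable3:
  assumes c: "outer_colouring G P c" and con: "consecutive (c o0) (c o1) (c o2) (c o3) (c o4)"
  shows "colourable3 G"
proof -
  define p q r where "p = c o2" and "q = c o3" and "r = c o0"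
  have pqr: "p \<noteq> q" "p \<noteq> r" "q \<noteq> r" "p < 3" "q < 3" "r < 3"
    and oc: "c o0 = r" "c o1 = r" "c o2 = p" "c o3 = q" "c o4 = r"
    using con c oE unfolding consecutive_def p_def q_def r_def outer_colouring_def by auto
  define c' where "c' = c(g0 := p, g1 := q, g2 := r, g3 := p, g4 := q)"
  have gc: "c' g0 = p" "c' g1 = q" "c' g2 = r" "c' g3 = p" "c' g4 = q"
    using dg unfolding c'_def by auto
  have oc': "c' o0 = r" "c' o1 = r" "c' o2 = p" "c' o3 = q" "c' o4 = r"
    using oc o_not_g unfolding c'_def by auto
  have "inj_on c' (inc_edges G x)" if x: "x \<in> verts G" for x
  proof (cases "x \<in> P")
    case True
    then consider "x = x0" | "x = x1" | "x = x2" | "x = x3" | "x = x4" by blast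
    then show ?thesis by cases (use inc gc oc' pqr in auto)
  next
    case False
    then have "e \<notin> {g0, g1, g2, g3, g4}" if "e \<in> inc_edges G x" for e
      using that g_ends_in_P unfolding inc_edges_def by blast
    then have "inj_on c' (inc_edges G x) = inj_on c (inc_edges G x)"
      by (intro inj_on_cong) (auto simp: c'_def)
    then show ?thesis using c x False unfolding outer_colouring_def by blast
  qed
  moreover have "c' e < 3" if "e \<in> edges G" for e
    using c that pqr unfolding c'_def outer_colouring_def by auto
  ultimately have "proper_3_edge_colouring G c'"
    unfolding proper_3_edge_colouring_iff[OF wf ll] by blast
  then show ?thesis unfolding colourable3_def by blast
qed

end

lemma (in cubic_pentagon) rotations_colourable3:
  assumes c: "outer_colouring G P c"
    and "consecutive (c o0) (c o1) (c o2) (c o3) (c o4) \<or> consecutive (c o1) (c o2) (c o3) (c o4) (c o0) \<or>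
      consecutive (c o2) (c o3) (c o4) (c o0) (c o1) \<or> consecutive (c o3) (c o4) (c o0) (c o1) (c o2) \<or>
      consecutive (c o4) (c o0) (c o1) (c o2) (c o3)"
  shows "colourable3 G"
proof -
  interpret r1: cubic_pentagon G x1 x2 x3 x4 x0 g1 g2 g3 g4 g0 o1 o2 o3 o4 o0 by (rule rotate)
  interpret r2: cubic_pentagon G x2 x3 x4 x0 x1 g2 g3 g4 g0 g1 o2 o3 o4 o0 o1 by (rule r1.rotate)
  interpret r3: cubic_pentagon G x3 x4 x0 x1 x2 g3 g4 g0 g1 g2 o3 o4 o0 o1 o2 by (rule r2.rotate)
  interpret r4: cubic_pentagon G x4 x0 x1 x2 x3 g4 g0 g1 g2 g3 o4 o0 o1 o2 o3 by (rule r3.rotate)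
  have "r1.P = P" "r2.P = P" "r3.P = P" "r4.P = P" by auto
  then have "outer_colouring G r1.P c" "outer_colouring G r2.P c" "outer_colouring G r3.P c"
    "outer_colouring G r4.P c" using c by simp_all
  then show ?thesis using assms consecutive_colourable3 r1.consecutive_colourable3
      r2.consecutive_colourable3 r3.consecutive_colourable3 r4.consecutive_colourable3 by blast
qed

context cubic_pentagon
begin

text \<open>Swapping colours along the Kempe chain starting at \<open>o4\<close> moves the centre from \<open>x0\<close> to \<open>x2\<close>;
  the other possible ends of the chain would make the graph colourable.\<close>

lemma kempe_step:
  assumes nc: "\<not> colourable3 G" and c: "outer_colouring G P c"
    and cen: "centred (c o0) (c o1) (c o2) (c o3) (c o4)"
  obtains c' where "outer_colouring G P c'" "centred (c' o2) (c' o3) (c' o4) (c' o0) (c' o1)"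
proof -
  define p q r where "p = c o1" and "q = c o4" and "r = c o0"
  have pqr: "p \<noteq> q" "p \<noteq> r" "q \<noteq> r" "p < 3" "q < 3" "r < 3"
    and oc: "c o0 = r" "c o1 = p" "c o2 = r" "c o3 = r" "c o4 = q"
    using cen c oE unfolding centred_def p_def q_def r_def outer_colouring_def by auto
  have no4: "o4 \<noteq> o0" "o4 \<noteq> o1" "o4 \<noteq> o2" "o4 \<noteq> o3" using oc pqr by auto
  obtain w where w: "ends G o4 = {#x4, w#}" "x4 \<noteq> w" "w \<in> verts G"
    using ends_eq_pair[OF wf ll oE(5) o_ends(5)] .
  \<comment> \<open>Among the five outer edges only \<open>o4\<close> has colour \<open>q\<close>,
    so it is not a chord.\<close>
  have wP: "w \<notin> P"
    using outer_third_edge[OF oE(5)] o_not_g no4 w by auto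
  define A where "A = {e \<in> edges G. c e = q \<or> c e = r}"
  have two: "card {e \<in> A. x \<in># ends G e} = 2" if x: "x \<in> verts G - P" for x
  proof -
    obtain a where a: "{f \<in> inc_edges G x. c f = q} = {a}"
      using outer_colour_class[OF cubic ll c _ _ pqr(5), of x] x by blast
    obtain b where b: "{f \<in> inc_edges G x. c f = r} = {b}"
      using outer_colour_class[OF cubic ll c _ _ pqr(6), of x] x by blast
    have "{e \<in> A. x \<in># ends G e} = {f \<in> inc_edges G x. c f = q} \<union> {f \<in> inc_edges G x. c f = r}"
      unfolding A_def inc_edges_def by blast
    moreover have "c a = q" "c b = r" using a b by auto
    then have "a \<noteq> b" using pqr(3) by auto
    ultimately show ?thesis unfolding a b by simp
  qed
  have sub: "A \<subseteq> edges G" "verts G - P \<subseteq> verts G" "w \<in> verts G - P" using w wP unfolding A_def by auto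
  \<comment> \<open>The set \<open>K\<close> replaces the Kempe chain through \<open>w\<close>: at
    most two edges of colours \<open>q\<close> and \<open>r\<close> leave it, and each of them ends
    in the pentagon.\<close>
  obtain K where K: "w \<in> K" "K \<subseteq> verts G - P" "card (boundary G A K) \<le> 2"
    "\<And>e. e \<in> boundary G A K \<Longrightarrow> \<exists>x \<in># ends G e. x \<notin> verts G - P"
    using kempe_set_exists[OF wf ll sub two] by blast
  define touch where "touch e \<longleftrightarrow> (\<exists>x \<in># ends G e. x \<in> K)" for e
  define s where "s i = (if i = q then r else if i = r then q else i)" for i
  have s_inj: "s i = s j \<longleftrightarrow> i = j" for i j using pqr unfolding s_def by auto
  define c' where "c' e = (if touch e then s (c e) else c e)" for e
  have outer': "outer_colouring G P c'"
    unfolding outer_colouring_def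
  proof (intro conjI ballI)
    fix e assume "e \<in> edges G"
    then have "c e < 3" using c unfolding outer_colouring_def by blast
    then show "c' e < 3" using pqr unfolding c'_def s_def by auto
  next
    fix x assume x: "x \<in> verts G - P"
    have inj: "inj_on c (inc_edges G x)" using c x unfolding outer_colouring_def by blast
    show "inj_on c' (inc_edges G x)"
    proof (cases "x \<in> K")
      case True
      then have "c' e = s (c e)" if "e \<in> inc_edges G x" for e
        using that unfolding c'_def touch_def inc_edges_def by auto
      then show ?thesis using inj s_inj unfolding inj_on_def by metis
    next
      case False
      \<comment> \<open>A recoloured edge at \<open>x\<close> would join \<open>x\<close> to
        \<open>K\<close> and be a boundary edge. Boundary edges have an end in the pentagon, but
        both ends of this one lie outside.\<close>
      have "c' e = c e" if e: "e \<in> inc_edges G x" for e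
      proof (rule ccontr)
        assume ne: "c' e \<noteq> c e"
        then have t: "touch e" and "c e = q \<or> c e = r" unfolding c'_def s_def by (auto split: if_splits)
        then have "e \<in> boundary G A K"
          using e False unfolding boundary_def A_def touch_def inc_edges_def by blast
        then obtain z where z: "z \<in># ends G e" "z \<notin> verts G - P" using K(4) by blast
        obtain y where y: "y \<in># ends G e" "y \<in> K" using t unfolding touch_def by blast
        have ex: "e \<in> edges G" "x \<in># ends G e" using e unfolding inc_edges_def by auto
        have "x \<noteq> y" using False y by blast
        then have "ends G e = {#x, y#}" using ends_eq_pair_of_mem[OF wf ll ex y(1)] by blast
        then have "z = x \<or> z = y" using z by auto
        then show False using x z y K(2) by blast
      qed
      then have "inj_on c' (inc_edges G x) = inj_on c (inc_edges G x)" by (rule inj_on_cong)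
      then show ?thesis using inj by simp
    qed
  qed
  have PK: "x \<notin> K" if "x \<in> P" for x using that K(2) by blast
  have t4: "touch o4" using w K(1) unfolding touch_def by auto
  have bd: "e \<in> boundary G A K" if "touch e" "e \<in> A" "x \<in># ends G e" "x \<in> P" for e x
    using that PK unfolding boundary_def touch_def by blast
  have oA: "o0 \<in> A" "o2 \<in> A" "o3 \<in> A" "o4 \<in> A" using oE oc unfolding A_def by auto
  have finb: "finite (boundary G A K)"
    using wf unfolding wf_graph_def boundary_def A_def by auto
  \<comment> \<open>The boundary of \<open>K\<close> has at most two edges and contains
    \<open>o4\<close>. So at most one of \<open>o0\<close>, \<open>o2\<close>, \<open>o3\<close> is
    recoloured.\<close>
  have one: "\<not> (touch e \<and> touch f)"
    if e: "e \<in> A" "x \<in># ends G e" "x \<in> P" "e \<noteq> o4"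
      and f: "f \<in> A" "y \<in># ends G f" "y \<in> P" "f \<noteq> o4" and "x \<noteq> y" for e f x y
  proof
    assume t: "touch e \<and> touch f"
    have "e \<noteq> f"
    proof
      assume "e = f"
      then have "ends G e = {#x, y#}"
        using ends_eq_pair_of_mem[OF wf ll _ e(2)] f(2) \<open>x \<noteq> y\<close> e(1) unfolding A_def by blast
      then show False using t PK[OF e(3)] PK[OF f(3)] unfolding touch_def by auto
    qed
    then have "card {o4, e, f} = 3" using e f by auto
    moreover have "{o4, e, f} \<subseteq> boundary G A K"
      using bd[OF _ e(1-3)] bd[OF _ f(1-3)] bd[OF t4 oA(4) o_ends(5)] t by auto
    ultimately show False using card_mono[OF finb, of "{o4, e, f}"] K(3) by simp
  qed
  have o02: "\<not> (touch o0 \<and> touch o2)"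
    by (rule one[OF oA(1) o_ends(1) _ no4(1)[symmetric] oA(2) o_ends(3) _ no4(3)[symmetric]]) (use dx in auto)
  have o03: "\<not> (touch o0 \<and> touch o3)"
    by (rule one[OF oA(1) o_ends(1) _ no4(1)[symmetric] oA(3) o_ends(4) _ no4(4)[symmetric]]) (use dx in auto)
  have o23: "\<not> (touch o2 \<and> touch o3)"
    by (rule one[OF oA(2) o_ends(3) _ no4(3)[symmetric] oA(3) o_ends(4) _ no4(4)[symmetric]]) (use dx in auto)
  have c'4: "c' o4 = r" and c'1: "c' o1 = p" using t4 oc pqr unfolding c'_def s_def by auto
  have c'o: "c' o0 = (if touch o0 then q else r)" "c' o2 = (if touch o2 then q else r)"
      "c' o3 = (if touch o3 then q else r)"
    using oc pqr unfolding c'_def s_def by auto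
  \<comment> \<open>After the switch \<open>o4\<close> has colour \<open>r\<close>. If none of
    \<open>o0\<close>, \<open>o2\<close>, \<open>o3\<close> changed to \<open>q\<close>, then
    \<open>p\<close> would occur once and \<open>q\<close> not at all, against parity.\<close>
  have par: "even (occ p (c' o0) (c' o1) (c' o2) (c' o3) (c' o4)) = even (occ q (c' o0) (c' o1) (c' o2) (c' o3) (c' o4))"
    using outer_parity[OF outer' pqr(4)] outer_parity[OF outer' pqr(5)] by presburger
  then have "touch o0 \<or> touch o2 \<or> touch o3"
    using pqr unfolding occ_def c'4 c'1 c'o by (auto split: if_splits)
  then consider "touch o0" "\<not> touch o2" "\<not> touch o3" | "\<not> touch o0" "touch o2" "\<not> touch o3"
    | "\<not> touch o0" "\<not> touch o2" "touch o3" using o02 o03 o23 by blast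
  then show thesis
  proof cases
    case 1
    then have "consecutive (c' o3) (c' o4) (c' o0) (c' o1) (c' o2)"
      using pqr unfolding consecutive_def c'4 c'1 c'o by auto
    then show thesis using rotations_colourable3[OF outer'] nc by blast
  next
    case 2
    then have "consecutive (c' o4) (c' o0) (c' o1) (c' o2) (c' o3)"
      using pqr unfolding consecutive_def c'4 c'1 c'o by auto
    then show thesis using rotations_colourable3[OF outer'] nc by blast
  next
    case 3
    then have "centred (c' o2) (c' o3) (c' o4) (c' o0) (c' o1)"
      using pqr unfolding centred_def c'4 c'1 c'o by auto
    then show thesis using that outer' by blast
  qed
qed

end

text \<open>Since 2 generates the residues modulo 5, steps by two reach every position: the centre
  moves along the indices 2, 4, 1, 3, 0.\<close>

lemma (in cubic_pentagon) centred_at_x0: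
  assumes nc: "\<not> colourable3 G" and c: "outer_colouring G P c"
  obtains c' where "outer_colouring G P c'" "centred (c' o0) (c' o1) (c' o2) (c' o3) (c' o4)"
proof -
  interpret r1: cubic_pentagon G x1 x2 x3 x4 x0 g1 g2 g3 g4 g0 o1 o2 o3 o4 o0 by (rule rotate)
  interpret r2: cubic_pentagon G x2 x3 x4 x0 x1 g2 g3 g4 g0 g1 o2 o3 o4 o0 o1 by (rule r1.rotate)
  interpret r3: cubic_pentagon G x3 x4 x0 x1 x2 g3 g4 g0 g1 g2 o3 o4 o0 o1 o2 by (rule r2.rotate)
  interpret r4: cubic_pentagon G x4 x0 x1 x2 x3 g4 g0 g1 g2 g3 o4 o0 o1 o2 o3 by (rule r3.rotate)
  have P: "r1.P = P" "r2.P = P" "r3.P = P" "r4.P = P" by auto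
  define C where "C a b c d e \<longleftrightarrow> (\<exists>k. outer_colouring G P k \<and> centred (k a) (k b) (k c) (k d) (k e))"
    for a b c d e
  have 1: "C o1 o2 o3 o4 o0 \<Longrightarrow> C o3 o4 o0 o1 o2"
    unfolding C_def using r1.kempe_step[OF nc, unfolded P] by metis
  have 3: "C o3 o4 o0 o1 o2 \<Longrightarrow> C o0 o1 o2 o3 o4"
    unfolding C_def using r3.kempe_step[OF nc, unfolded P] by metis
  have 2: "C o2 o3 o4 o0 o1 \<Longrightarrow> C o4 o0 o1 o2 o3"
    unfolding C_def using r2.kempe_step[OF nc, unfolded P] by metis
  have 4: "C o4 o0 o1 o2 o3 \<Longrightarrow> C o1 o2 o3 o4 o0"
    unfolding C_def using r4.kempe_step[OF nc, unfolded P] by metis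
  let ?occ = "\<lambda>i. occ i (c o0) (c o1) (c o2) (c o3) (c o4)"
  have "even (?occ 0) = even (?occ 1)" "even (?occ 1) = even (?occ 2)"
    using outer_parity[OF c, of 0] outer_parity[OF c, of 1] outer_parity[OF c, of 2] by simp_all
  moreover have "c o0 < 3" "c o1 < 3" "c o2 < 3" "c o3 < 3" "c o4 < 3"
    using c oE unfolding outer_colouring_def by auto
  ultimately have "centred (c o0) (c o1) (c o2) (c o3) (c o4) \<or> centred (c o1) (c o2) (c o3) (c o4) (c o0) \<or>
      centred (c o2) (c o3) (c o4) (c o0) (c o1) \<or> centred (c o3) (c o4) (c o0) (c o1) (c o2) \<or>
      centred (c o4) (c o0) (c o1) (c o2) (c o3)"
    using five_colours_cases[of "c o0" "c o1" "c o2" "c o3" "c o4"] rotations_colourable3[OF c] nc by blast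
  then have "C o0 o1 o2 o3 o4 \<or> C o1 o2 o3 o4 o0 \<or> C o2 o3 o4 o0 o1 \<or> C o3 o4 o0 o1 o2 \<or> C o4 o0 o1 o2 o3"
    unfolding C_def using c by blast
  then have "C o0 o1 o2 o3 o4" using 1 2 3 4 by blast
  then show thesis using that unfolding C_def by blast
qed

section \<open>From a heavy pentagon to a hexagonal core\<close>

text \<open>The lists are unpacked into named vertices and edges, and rotations put \<open>v\<close>
  in first position.\<close>

lemma cubic_pentagon_at_vertex:
  assumes G: "cubic G" "loopless G" and pent: "pentagon G xs es" and v: "v \<in> set xs"
  obtains x1 x2 x3 x4 g0 g1 g2 g3 g4 o0 o1 o2 o3 o4
    where "cubic_pentagon G v x1 x2 x3 x4 g0 g1 g2 g3 g4 o0 o1 o2 o3 o4" "{v, x1, x2, x3, x4} = set xs"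
proof -
  have "length xs = 5" "length es = 5" using pent unfolding pentagon_def by blast+
  then obtain y0 y1 y2 y3 y4 h0 h1 h2 h3 h4
    where xs: "xs = [y0, y1, y2, y3, y4]" and es: "es = [h0, h1, h2, h3, h4]"
    by (auto simp: length_Suc_conv numeral_eq_Suc)
  have dx: "distinct [y0, y1, y2, y3, y4]" and dg: "distinct [h0, h1, h2, h3, h4]"
    and yV: "{y0, y1, y2, y3, y4} \<subseteq> verts G"
    using pent unfolding pentagon_def xs es by auto
  have step: "es ! i \<in> edges G \<and> ends G (es ! i) = {# xs ! i, xs ! ((i + 1) mod 5) #}" if "i < 5" for i
    using pent that unfolding pentagon_def by blast
  have eg: "ends G h0 = {#y0, y1#}" "ends G h1 = {#y1, y2#}" "ends G h2 = {#y2, y3#}"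
      "ends G h3 = {#y3, y4#}" "ends G h4 = {#y4, y0#}"
    and gE: "h0 \<in> edges G" "h1 \<in> edges G" "h2 \<in> edges G" "h3 \<in> edges G" "h4 \<in> edges G"
    using step[of 0] step[of 1] step[of 2] step[of 3] step[of 4] unfolding xs es by simp_all
  have ex: "\<exists>k. inc_edges G y = {g, h, k} \<and> distinct [g, h, k]"
    if "y \<in> verts G" "g \<in> edges G" "h \<in> edges G" "y \<in># ends G g" "y \<in># ends G h" "g \<noteq> h" for y g h
    using third_edge[OF G that(1), of g h] that unfolding inc_edges_def by auto
  obtain k0 where k0: "inc_edges G y0 = {h4, h0, k0}" "distinct [h4, h0, k0]"
    using ex[of y0 h4 h0] yV gE eg dg by auto
  obtain k1 where k1: "inc_edges G y1 = {h0, h1, k1}" "distinct [h0, h1, k1]"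
    using ex[of y1 h0 h1] yV gE eg dg by auto
  obtain k2 where k2: "inc_edges G y2 = {h1, h2, k2}" "distinct [h1, h2, k2]"
    using ex[of y2 h1 h2] yV gE eg dg by auto
  obtain k3 where k3: "inc_edges G y3 = {h2, h3, k3}" "distinct [h2, h3, k3]"
    using ex[of y3 h2 h3] yV gE eg dg by auto
  obtain k4 where k4: "inc_edges G y4 = {h3, h4, k4}" "distinct [h3, h4, k4]"
    using ex[of y4 h3 h4] yV gE eg dg by auto
  have r0: "cubic_pentagon G y0 y1 y2 y3 y4 h0 h1 h2 h3 h4 k0 k1 k2 k3 k4"
    by unfold_locales (fact G dx yV eg k0 k1 k2 k3 k4)+
  note r1 = cubic_pentagon.rotate[OF r0]
  note r2 = cubic_pentagon.rotate[OF r1]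
  note r3 = cubic_pentagon.rotate[OF r2]
  note r4 = cubic_pentagon.rotate[OF r3]
  have "{y0, y1, y2, y3, y4} = set xs" "{y1, y2, y3, y4, y0} = set xs" "{y2, y3, y4, y0, y1} = set xs"
    "{y3, y4, y0, y1, y2} = set xs" "{y4, y0, y1, y2, y3} = set xs" unfolding xs by auto
  moreover have "v = y0 \<or> v = y1 \<or> v = y2 \<or> v = y3 \<or> v = y4" using v unfolding xs by auto
  ultimately show thesis using that r0 r1 r2 r3 r4 by metis
qed

lemma defect_eq_3:
  assumes "cubic H" "loopless H" "\<not> colourable3 H" "three_array H M" "card (uncovered H M) = 3"
  shows "defect H = 3"
  unfolding defect_def
proof (rule Least_equality)
  show "\<exists>M. three_array H M \<and> card (uncovered H M) = 3" using assms by blast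
  fix n assume "\<exists>M. three_array H M \<and> card (uncovered H M) = n"
  then obtain N where N: "three_array H N" "card (uncovered H N) = n" by blast
  then show "3 \<le> n" using array_structure(1)[OF assms(1-3) N(1)] by (cases "n \<le> 3") auto
qed

lemma ex1_of_three:
  assumes "distinct [e1, e2, e3]"
    and "(e1 \<in> M \<and> e2 \<notin> M \<and> e3 \<notin> M) \<or> (e1 \<notin> M \<and> e2 \<in> M \<and> e3 \<notin> M) \<or> (e1 \<notin> M \<and> e2 \<notin> M \<and> e3 \<in> M)"
  shows "\<exists>!e. e \<in> M \<and> e \<in> {e1, e2, e3}"
  using assms by auto

text \<open>This reverses the contraction: the hexagon runs through \<open>Inr g0\<close>,
  \<open>Inl x1\<close>, \<open>Inl x2\<close>, \<open>Inl x3\<close>, \<open>Inl x4\<close>,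
  \<open>Inr g4\<close>. The edges \<open>g0\<close>, \<open>g2\<close>, \<open>g4\<close> become
  double, while \<open>g1\<close>, \<open>g3\<close> and the triangle edge
  \<open>Inr {g0, g4}\<close> stay uncovered.\<close>

lemma (in cubic_pentagon) centred_imp_hex_core:
  assumes nc: "\<not> colourable3 G" and c: "outer_colouring G P c"
    and cen: "centred (c o0) (c o1) (c o2) (c o3) (c o4)"
  shows "has_hex_core_meeting (inflate G x0) (triangle G x0)"
proof -
  define H where "H = inflate G x0"
  have x0V: "x0 \<in> verts G" using xV by simp
  have wH: "wf_graph H" and lH: "loopless H" and cH: "cubic H" and nH: "\<not> colourable3 H"
    unfolding H_def using wf_inflate[OF wf x0V] loopless_inflate[OF wf ll] cubic_inflate[OF cubic ll x0V]
      inflate_not_colourable3[OF cubic ll x0V nc] by simp_all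
  define p q r where "p = c o1" and "q = c o4" and "r = c o0"
  have pqr: "p \<noteq> q" "p \<noteq> r" "q \<noteq> r" "p < 3" "q < 3" "r < 3"
    and oc: "c o0 = r" "c o1 = p" "c o2 = r" "c o3 = r" "c o4 = q"
    using cen c oE unfolding centred_def p_def q_def r_def outer_colouring_def by auto
  have all3: "i = p \<or> i = q \<or> i = r" if "i < 3" for i using pqr that by linarith
  let ?g = "{g0, g1, g2, g3, g4}"
  \<comment> \<open>Each colour class outside the pentagon is completed to a perfect matching. For
    \<open>p\<close> and \<open>q\<close>, whose outer edges end at \<open>x1\<close> and
    \<open>x4\<close>, a triangle edge at \<open>Inr o0\<close> is needed; for \<open>r\<close>, the
    edges \<open>o0\<close>, \<open>o2\<close>, \<open>o3\<close> cover \<open>Inr o0\<close>,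
    \<open>Inl x2\<close> and \<open>Inl x3\<close>.\<close>
  define M where "M i = Inl ` {e \<in> edges G. e \<notin> ?g \<and> c e = i} \<union>
     (if i = p then {Inl g4, Inl g2, Inr {g0, o0}}
      else if i = q then {Inl g0, Inl g2, Inr {g4, o0}} else {Inl g0, Inl g4})" for i
  have Mo: "Inl e \<in> M i \<longleftrightarrow> c e = i" if "e \<in> edges G" "e \<notin> ?g" for e i
    using that unfolding M_def by auto
  have Mo': "Inl o0 \<in> M i \<longleftrightarrow> r = i" "Inl o1 \<in> M i \<longleftrightarrow> p = i" "Inl o2 \<in> M i \<longleftrightarrow> r = i"
      "Inl o3 \<in> M i \<longleftrightarrow> r = i" "Inl o4 \<in> M i \<longleftrightarrow> q = i" for i
    using Mo[OF oE(1)] Mo[OF oE(2)] Mo[OF oE(3)] Mo[OF oE(4)] Mo[OF oE(5)] o_not_g oc by auto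
  have Mg: "Inl g0 \<in> M i \<longleftrightarrow> i \<noteq> p" "Inl g1 \<notin> M i" "Inl g2 \<in> M i \<longleftrightarrow> i = p \<or> i = q"
      "Inl g3 \<notin> M i" "Inl g4 \<in> M i \<longleftrightarrow> i \<noteq> q" for i
    using dg pqr unfolding M_def by auto
  have sets: "{g0, o0} \<noteq> {g4, o0}" "{g0, g4} \<noteq> {g0, o0}" "{g0, g4} \<noteq> {g4, o0}"
    using di(1) by (auto simp: doubleton_eq_iff)
  have MT: "Inr {g0, o0} \<in> M i \<longleftrightarrow> i = p" "Inr {g4, o0} \<in> M i \<longleftrightarrow> i = q" "Inr {g0, g4} \<notin> M i" for i
    using sets pqr unfolding M_def by auto
  have TE: "Inr {g0, o0} \<in> edges H" "Inr {g4, o0} \<in> edges H" "Inr {g0, g4} \<in> edges H"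
    unfolding H_def Inr_in_edges_inflate inc(1) using di(1) by auto
  have Msub: "M i \<subseteq> edges H" for i
  proof
    fix f assume "f \<in> M i"
    then have "f \<in> Inl ` edges G \<or> f = Inr {g0, o0} \<or> f = Inr {g4, o0}"
      using gE unfolding M_def by (auto split: if_splits)
    then show "f \<in> edges H" using TE by (auto simp: H_def Inl_in_edges_inflate)
  qed
  have x0_ne: "x1 \<noteq> x0" "x2 \<noteq> x0" "x3 \<noteq> x0" "x4 \<noteq> x0" using dx by auto
  have incl: "inc_edges H (Inl x) = Inl ` inc_edges G x" if "x \<noteq> x0" for x
    unfolding H_def using inc_edges_inflate_Inl[OF that] .
  have "\<exists>!e. e \<in> M i \<and> e \<in> inc_edges H x" if i: "i < 3" and x: "x \<in> verts H" for i x
  proof -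
    have "x \<in> Inl ` (verts G - P) \<or> x \<in> {Inl x1, Inl x2, Inl x3, Inl x4} \<or> x \<in> {Inr g0, Inr g4, Inr o0}"
      using x unfolding H_def verts_inflate inc(1) by auto
    then consider y where "x = Inl y" "y \<in> verts G" "y \<notin> P"
      | "x = Inl x1" | "x = Inl x2" | "x = Inl x3" | "x = Inl x4"
      | "x = Inr g0" | "x = Inr g4" | "x = Inr o0" by blast
    then show ?thesis
    proof cases
      case 1
      obtain e where e: "{f \<in> inc_edges G y. c f = i} = {e}"
        using outer_colour_class[OF cubic ll c 1(2,3) i] .
      have "Inl f \<in> M i \<longleftrightarrow> c f = i" if "f \<in> inc_edges G y" for f
        using that 1 g_ends_in_P Mo unfolding inc_edges_def by blast
      moreover have "inc_edges H x = Inl ` inc_edges G y" using incl 1 by blast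
      ultimately have "{f. f \<in> M i \<and> f \<in> inc_edges H x} = Inl ` {f \<in> inc_edges G y. c f = i}" by auto
      then have "{f. f \<in> M i \<and> f \<in> inc_edges H x} = {Inl e}" unfolding e by simp
      then show ?thesis by (metis (no_types, lifting) mem_Collect_eq singletonD singletonI)
    next
      case 2
      have "inc_edges H x = {Inl g0, Inl g1, Inl o1}" using incl[OF x0_ne(1)] inc 2 by simp
      then show ?thesis using ex1_of_three[of "Inl g0" "Inl g1" "Inl o1" "M i"] di(2) Mo' Mg pqr all3[OF i]
        by auto
    next
      case 3
      have "inc_edges H x = {Inl g1, Inl g2, Inl o2}" using incl[OF x0_ne(2)] inc 3 by simp
      then show ?thesis using ex1_of_three[of "Inl g1" "Inl g2" "Inl o2" "M i"] di(3) Mo' Mg pqr all3[OF i]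
        by auto
    next
      case 4
      have "inc_edges H x = {Inl g2, Inl g3, Inl o3}" using incl[OF x0_ne(3)] inc 4 by simp
      then show ?thesis using ex1_of_three[of "Inl g2" "Inl g3" "Inl o3" "M i"] di(4) Mo' Mg pqr all3[OF i]
        by auto
    next
      case 5
      have "inc_edges H x = {Inl g3, Inl g4, Inl o4}" using incl[OF x0_ne(4)] inc 5 by simp
      then show ?thesis using ex1_of_three[of "Inl g3" "Inl g4" "Inl o4" "M i"] di(5) Mo' Mg pqr all3[OF i]
        by auto
    next
      case 6
      have "inc_edges H x = {Inl g0, Inr {g0, g4}, Inr {g0, o0}}"
        unfolding H_def 6 by (rule inc_edges_inflate_Inr) (use inc(1) di(1) in auto)
      then show ?thesis using ex1_of_three[of "Inl g0" "Inr {g0, g4}" "Inr {g0, o0}" "M i"]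
          sets Mg MT pqr all3[OF i] by auto
    next
      case 7
      have "inc_edges H x = {Inl g4, Inr {g4, g0}, Inr {g4, o0}}"
        unfolding H_def 7 by (rule inc_edges_inflate_Inr) (use inc(1) di(1) in auto)
      then have "inc_edges H x = {Inl g4, Inr {g0, g4}, Inr {g4, o0}}"
        using insert_commute[of g4 g0 "{}"] by simp
      then show ?thesis using ex1_of_three[of "Inl g4" "Inr {g0, g4}" "Inr {g4, o0}" "M i"]
          sets Mg MT pqr all3[OF i] by auto
    next
      case 8
      have "inc_edges H x = {Inl o0, Inr {o0, g0}, Inr {o0, g4}}"
        unfolding H_def 8 by (rule inc_edges_inflate_Inr) (use inc(1) di(1) in auto)
      then have "inc_edges H x = {Inl o0, Inr {g0, o0}, Inr {g4, o0}}"
        using insert_commute[of o0 g0 "{}"] insert_commute[of o0 g4 "{}"] by simp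
      then show ?thesis using ex1_of_three[of "Inl o0" "Inr {g0, o0}" "Inr {g4, o0}" "M i"]
          sets Mo' MT pqr all3[OF i] by auto
    qed
  qed
  moreover have "e \<in> M i \<and> e \<in> inc_edges H x \<longleftrightarrow> e \<in> M i \<and> x \<in># ends H e" for e i x
    using Msub unfolding inc_edges_def by blast
  ultimately have arr: "three_array H M"
    using Msub unfolding three_array_def perfect_matching_iff[OF wH lH] by simp
  have unc: "uncovered H M = {Inl g1, Inl g3, Inr {g0, g4}}"
  proof
    show "{Inl g1, Inl g3, Inr {g0, g4}} \<subseteq> uncovered H M"
      unfolding uncovered_def cover_count_0_iff
      using Mg MT TE gE by (auto simp: H_def Inl_in_edges_inflate)
    show "uncovered H M \<subseteq> {Inl g1, Inl g3, Inr {g0, g4}}"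
    proof
      fix f assume "f \<in> uncovered H M"
      then have f: "f \<in> edges H" "\<And>i. i < 3 \<Longrightarrow> f \<notin> M i"
        unfolding uncovered_def cover_count_0_iff by auto
      show "f \<in> {Inl g1, Inl g3, Inr {g0, g4}}"
      proof (cases f)
        case (Inl e)
        then have eE: "e \<in> edges G" using f(1) by (simp add: H_def Inl_in_edges_inflate)
        then have "c e < 3" using c unfolding outer_colouring_def by blast
        then have "e \<in> ?g" using Mo[OF eE] f(2)[of "c e"] Inl by blast
        moreover have "e \<noteq> g0" "e \<noteq> g4" "e \<noteq> g2"
          using f(2)[OF pqr(6)] f(2)[OF pqr(4)] Mg pqr Inl by metis+
        ultimately show ?thesis using Inl by blast
      next
        case (Inr s)
        then obtain e1 e2 where "s = {e1, e2}" "e1 \<in> {g4, g0, o0}" "e2 \<in> {g4, g0, o0}" "e1 \<noteq> e2"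
          using f(1) inc(1) by (auto simp: H_def Inr_in_edges_inflate)
        then have "s = {g0, g4} \<or> s = {g0, o0} \<or> s = {g4, o0}" by auto
        then show ?thesis using f(2)[OF pqr(4)] f(2)[OF pqr(5)] MT Inr by blast
      qed
    qed
  qed
  have c3: "card (uncovered H M) = 3" unfolding unc using dg by auto
  have df: "defect H = 3" using defect_eq_3[OF cH lH nH arr c3] .
  have "Inr {g0, g4} \<in> uncovered H M" using unc by simp
  then have "Inr {g0, g4} \<in> core_edges H M" unfolding uncovered_def core_edges_def by simp
  moreover have "Inr g0 \<in># ends H (Inr {g0, g4})" by (simp add: H_def mem_ends_inflate)
  ultimately have "Inr g0 \<in> core_verts H M" unfolding core_verts_def by blast
  moreover have "Inr g0 \<in> triangle G x0" unfolding triangle_def inc(1) by blast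
  ultimately show ?thesis
    using df arr c3 unfolding has_hex_core_meeting_def optimal_array_def H_def by (metis disjoint_iff)
qed

lemma heavy_pentagon_imp_hexagonal_core:
  assumes G: "cubic G" "loopless G" "\<not> colourable3 G" and heavy: "on_heavy_pentagon G v"
  shows "has_hex_core_meeting (inflate G v) (triangle G v)"
proof -
  obtain xs es i where pent: "pentagon G xs es" and v: "v \<in> set xs" and i: "i < 5"
    and col: "colourable3 (del_verts G {xs ! i, xs ! ((i + 1) mod 5)})"
    using heavy unfolding on_heavy_pentagon_def heavy_pentagon_def by blast
  have "length xs = 5" using pent unfolding pentagon_def by blast
  then have S: "{xs ! i, xs ! ((i + 1) mod 5)} \<subseteq> set xs" using i by (auto intro: nth_mem)
  obtain c where c: "outer_colouring G (set xs) c"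
    using outer_colouring_of_deleted[OF G(1,2) S col] .
  obtain x1 x2 x3 x4 g0 g1 g2 g3 g4 o0 o1 o2 o3 o4
    where "cubic_pentagon G v x1 x2 x3 x4 g0 g1 g2 g3 g4 o0 o1 o2 o3 o4"
      and xs: "{v, x1, x2, x3, x4} = set xs"
    using cubic_pentagon_at_vertex[OF G(1,2) pent v] .
  then interpret cubic_pentagon G v x1 x2 x3 x4 g0 g1 g2 g3 g4 o0 o1 o2 o3 o4 by simp
  obtain c' where "outer_colouring G P c'" "centred (c' o0) (c' o1) (c' o2) (c' o3) (c' o4)"
    using centred_at_x0[OF G(3)] c xs by metis
  then show ?thesis using centred_imp_hex_core[OF G(3)] by blast
qed

theorem theorem3p5:
  fixes G :: "('v, 'e) mgraph" and v :: 'v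
  assumes "snark G" and "v \<in> verts G"
  shows "has_hex_core_meeting (inflate G v) (triangle G v) \<longleftrightarrow> on_heavy_pentagon G v"
proof
  have G: "cubic G" "loopless G" "\<not> colourable3 G"
    using assms(1) snark_loopless unfolding snark_def by auto
  show "on_heavy_pentagon G v" if hex: "has_hex_core_meeting (inflate G v) (triangle G v)"
  proof -
    obtain M where "defect (inflate G v) = 3" "optimal_array (inflate G v) M"
      "core_verts (inflate G v) M \<inter> triangle G v \<noteq> {}"
      using hex unfolding has_hex_core_meeting_def by blast
    then show ?thesis
      using hexagonal_core_imp_heavy_pentagon[OF G assms(2)] unfolding optimal_array_def by metis
  qed
  show "has_hex_core_meeting (inflate G v) (triangle G v)" if "on_heavy_pentagon G v"
    using heavy_pentagon_imp_hexagonal_core[OF G that] .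
qed

end
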